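(* Let $\theta$ be an injective primitive, length $r$ substitution on $\mathcal A$, with column number $c$, of height one, and such that $(X_\theta,\sigma)$ is infinite. Let $p\ge1$ and $0<k<r^p-1$ be integers. Let $f:\mathcal A^2\to\mathcal A$. Then $\Phi:=\Phi^f_{1,0}$ satisfies $\Phi\in\mathrm{Aut}(X_\theta,\sigma)$ and $\kappa(\Phi)=k/(1-r^p)$ if and only if: (1) if $x_0x_1x_2\in\mathcal L_{X_\theta}$, then $f(x_0,x_1)f(x_1,x_2)\in\mathcal L_{X_\theta}$; and (2) for each $x_{-1}x_0x_1\in\mathcal L_{X_\theta}$ and $0\le i<r^{c!p}$, $$f\big(\theta^{c!p}(x_{-1}\cdot x_0)_{i-1},\ \theta^{c!p}(x_{-1}\cdot x_0)_i\big)=\theta^{c!p}\big(f(x_{-1},x_0)f(x_0,x_1)\big)_{N+i},$$ where $N=k(1+r^p+\cdots+r^{(c!-1)p})$. Similarly, given $g:\mathcal A^3\to\mathcal A$, $\Phi^g_{1,1}$ satisfies $\Phi^g_{1,1}\in\mathrm{Aut}(X_\theta,\sigma)$ and $\kappa(\Phi^g_{1,1})=0$ if and only if (3) $g(x_0,x_1,x_2)g(x_1,x_2,x_3)\in\mathcal L_{X_\theta}$ whenever $x_0x_1x_2x_3\in\mathcal L_{X_\theta}$; and (4) for any $x_{-1}x_0x_1\in\mathcal L_{X_\theta}$ and $0\le i<r^{c!}$, $$g(u_{i-1},u_i,u_{i+1})=\big(\theta^{c!}(g(x_{-1},x_0,x_1))\big)_i,$$ where $u=u_{-r^{c!}}u_{-r^{c!}+1}\ldots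 u_{-1}\cdot u_0\ldots u_{2r^{c!}-1}$ is the word obtained by applying $\theta^{c!}$ to the word $x_{-1}\cdot x_0x_1$.
   Context: $\mathcal A$ is a finite alphabet. A substitution of length $r$ is a map $\theta:\mathcal A\to\mathcal A^r$, extended by concatenation to finite words and to bi-infinite sequences ($\theta(x_0)$ occupying coordinates $0,\ldots,r-1$); write $\theta(a)=\theta_0(a)\cdots\theta_{r-1}(a)$, so each $\theta_i:\mathcal A\to\mathcal A$. $\theta$ is injective if $\theta(a)\ne\theta(b)$ for distinct letters $a,b$; primitive if for some $k$, every letter occurs in $\theta^k(a)$ for every letter $a$. $X_\theta\subset\mathcal A^{\mathbb Z}$ is the two-sided shift of all bi-infinite sequences all of whose finite subwords occur in a one-sided $\theta$-periodic point, with shift map $\sigma$; $\mathcal L_{X_\theta}$ is its language (finite words occurring in points of $X_\theta$); $\mathrm{Aut}(X_\theta,\sigma)$ is the group of self-homeomorphisms of $X_\theta$ commuting with $\sigma$. Height: with $u=u_0u_1\ldots$ a fixed point of $\theta$ (or of a power of $\theta$), $h(\theta)=\max\{n\ge1:\gcd(n,r)=1,\ n\mid\gcd\{a:u_a=u_0\}\}$. The column number of a height-one $\theta$ is $c=\min|\theta_{i_1}\circ\cdots\circ\theta_{i_k}(\mathcal A)|$ over all $k\ge1$ and $i_1,\ldots,i_k\in\{0,\ldots,r-1\}$. $\mathbb Z_r$ is the additive group of $r$-adic integers ($r$ not necessarily prime). The maximal equicontinuous factor of $(X_\theta,\sigma)$ is $(\mathbb Z_r,+1)$, with factor map $\pi:X_\theta\to\mathbb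 Z_r$ determined by: for each $n$, $\pi(x)\equiv i\pmod{r^n}$, $0\le i<r^n$, iff $x\in\sigma^i(\theta^n(X_\theta))$. For $\Phi\in\mathrm{Aut}(X_\theta,\sigma)$, $\kappa(\Phi)\in\mathbb Z_r$ is the unique element with $\pi(\Phi(x))=\kappa(\Phi)+\pi(x)$ for all $x$. For $f:\mathcal A^{m+n+1}\to\mathcal A$, $\Phi^f_{m,n}:\mathcal A^{\mathbb Z}\to\mathcal A^{\mathbb Z}$ is $\Phi^f_{m,n}(x)_i=f(x_{i-m},\ldots,x_{i+n})$; "$\Phi^f_{m,n}\in\mathrm{Aut}(X_\theta,\sigma)$" refers to its restriction to $X_\theta$. The notation $x_{-1}\cdot x_0$ denotes a finite segment of a bi-infinite sequence with $x_{-1}$ in coordinate $-1$ and $x_0$ in coordinate $0$; thus $\theta^{n}(x_{-1}\cdot x_0)$ occupies coordinates $-r^n,\ldots,r^n-1$, with $\theta^n(x_0)$ starting at coordinate $0$. Words without a dot are indexed from $0$. *)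

theory Defs
  imports "HOL-Analysis.Function_Topology" "HOL-Algebra.Ring"
begin

section \<open>Constant length substitutions\<close>

text \<open>A letter-to-word map \<open>\<theta>\<close> on the finite alphabet \<open>'a\<close>. Its extensions to infinite sequences
  are only meaningful when \<open>\<theta>\<close> has constant length \<open>r\<close>, which they take as an argument.\<close>

type_synonym 'a substitution = "'a \<Rightarrow> 'a list"

definition has_length :: "nat \<Rightarrow> 'a substitution \<Rightarrow> bool" where
  "has_length r \<theta> \<longleftrightarrow> (\<forall>a. length (\<theta> a) = r)"

definition subst_word :: "'a substitution \<Rightarrow> 'a list \<Rightarrow> 'a list" where
  "subst_word \<theta> w = concat (map \<theta> w)"

definition subst_one_sided :: "nat \<Rightarrow> 'a substitution \<Rightarrow> (nat \<Rightarrow> 'a) \<Rightarrow> (nat \<Rightarrow> 'a)" where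
  "subst_one_sided r \<theta> u = (\<lambda>i. \<theta> (u (i div r)) ! (i mod r))"

text \<open>\<open>div\<close> on \<open>int\<close> rounds down, so \<open>\<theta> (x 0)\<close> occupies the coordinates \<open>0, \<dots>, r - 1\<close> and
  \<open>\<theta> (x (- 1))\<close> the coordinates \<open>- r, \<dots>, - 1\<close>.\<close>

definition subst_two_sided :: "nat \<Rightarrow> 'a substitution \<Rightarrow> (int \<Rightarrow> 'a) \<Rightarrow> (int \<Rightarrow> 'a)" where
  "subst_two_sided r \<theta> x = (\<lambda>i. \<theta> (x (i div int r)) ! nat (i mod int r))"

definition primitive :: "'a substitution \<Rightarrow> bool" where
  "primitive \<theta> \<longleftrightarrow> (\<exists>k. \<forall>a b. b \<in> set ((subst_word \<theta> ^^ k) [a]))"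

definition periodic_point :: "nat \<Rightarrow> 'a substitution \<Rightarrow> (nat \<Rightarrow> 'a) \<Rightarrow> bool" where
  "periodic_point r \<theta> u \<longleftrightarrow> (\<exists>n\<ge>1. (subst_one_sided r \<theta> ^^ n) u = u)"

text \<open>The height: for primitive \<open>\<theta>\<close> the value does not depend on the choice of \<open>u\<close>.\<close>

definition height :: "nat \<Rightarrow> 'a substitution \<Rightarrow> nat" where
  "height r \<theta> =
    (let u = (SOME u. periodic_point r \<theta> u)
     in Max {n. n \<ge> 1 \<and> coprime n r \<and> n dvd Gcd {a. u a = u 0}})"

definition column :: "'a substitution \<Rightarrow> nat \<Rightarrow> 'a \<Rightarrow> 'a" where
  "column \<theta> i = (\<lambda>a. \<theta> a ! i)"

definition column_number :: "nat \<Rightarrow> 'a::finite substitution \<Rightarrow> nat" where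
  "column_number r \<theta> =
    Min {card (range (foldr (\<lambda>i F. column \<theta> i \<circ> F) is id)) | is. is \<noteq> [] \<and> set is \<subseteq> {..<r}}"

section \<open>The substitution shift, its language and its automorphisms\<close>

definition shift :: "(int \<Rightarrow> 'a) \<Rightarrow> (int \<Rightarrow> 'a)" where
  "shift x = (\<lambda>i. x (i + 1))"

definition occurs_one_sided :: "'a list \<Rightarrow> (nat \<Rightarrow> 'a) \<Rightarrow> bool" where
  "occurs_one_sided w u \<longleftrightarrow> (\<exists>j. \<forall>i<length w. w ! i = u (j + i))"

definition occurs_two_sided :: "'a list \<Rightarrow> (int \<Rightarrow> 'a) \<Rightarrow> bool" where
  "occurs_two_sided w x \<longleftrightarrow> (\<exists>j. \<forall>i<length w. w ! i = x (j + int i))"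

definition subst_shift :: "nat \<Rightarrow> 'a substitution \<Rightarrow> (int \<Rightarrow> 'a) set" where
  "subst_shift r \<theta> =
    {x. \<forall>w. occurs_two_sided w x \<longrightarrow> (\<exists>u. periodic_point r \<theta> u \<and> occurs_one_sided w u)}"

definition language :: "nat \<Rightarrow> 'a substitution \<Rightarrow> 'a list set" where
  "language r \<theta> = {w. \<exists>x\<in>subst_shift r \<theta>. occurs_two_sided w x}"

definition subst_shift_topology :: "nat \<Rightarrow> 'a substitution \<Rightarrow> (int \<Rightarrow> 'a) topology" where
  "subst_shift_topology r \<theta> =
    subtopology (product_topology (\<lambda>_. discrete_topology UNIV) UNIV) (subst_shift r \<theta>)"

text \<open>Maps on the shift space are represented by functions that are undefined outside it.\<close>

definition Aut :: "nat \<Rightarrow> 'a substitution \<Rightarrow> ((int \<Rightarrow> 'a) \<Rightarrow> (int \<Rightarrow> 'a)) set" where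
  "Aut r \<theta> =
    {\<Phi> \<in> extensional (subst_shift r \<theta>).
      homeomorphic_map (subst_shift_topology r \<theta>) (subst_shift_topology r \<theta>) \<Phi> \<and>
      (\<forall>x\<in>subst_shift r \<theta>. \<Phi> (shift x) = shift (\<Phi> x))}"

text \<open>A local rule \<open>f : A\<^sup>m\<^sup>+\<^sup>n\<^sup>+\<^sup>1 \<rightarrow> A\<close> is a function on words; only its values on
  words of length \<open>m + n + 1\<close> are used.\<close>

definition block_map :: "nat \<Rightarrow> nat \<Rightarrow> ('a list \<Rightarrow> 'a) \<Rightarrow> (int \<Rightarrow> 'a) \<Rightarrow> (int \<Rightarrow> 'a)" where
  "block_map m n f x = (\<lambda>i. f (map x [i - int m..i + int n]))"

definition block_map_on ::
    "nat \<Rightarrow> 'a substitution \<Rightarrow> nat \<Rightarrow> nat \<Rightarrow> ('a list \<Rightarrow> 'a) \<Rightarrow> (int \<Rightarrow> 'a) \<Rightarrow> (int \<Rightarrow> 'a)" where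
  "block_map_on r \<theta> m n f = restrict (block_map m n f) (subst_shift r \<theta>)"

section \<open>The ring of r-adic integers\<close>

text \<open>The inverse limit of the rings \<open>\<int> / r\<^sup>n\<int>\<close>, where \<open>z n\<close> is the representative of \<open>z\<close>
  modulo \<open>r\<^sup>n\<close> in \<open>{0..<r\<^sup>n}\<close>. The number \<open>r\<close> need not be prime.\<close>

definition radic :: "nat \<Rightarrow> (nat \<Rightarrow> int) ring" where
  "radic r =
    \<lparr>carrier = {z. \<forall>n. z n \<in> {0..<int r ^ n} \<and> z (Suc n) mod int r ^ n = z n},
     mult = (\<lambda>y z n. (y n * z n) mod int r ^ n),
     one = (\<lambda>n. 1 mod int r ^ n),
     zero = (\<lambda>n. 0),
     add = (\<lambda>y z n. (y n + z n) mod int r ^ n)\<rparr>"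

definition radic_of_int :: "nat \<Rightarrow> int \<Rightarrow> (nat \<Rightarrow> int)" where
  "radic_of_int r a = (\<lambda>n. a mod int r ^ n)"

text \<open>The quotient \<open>a / b\<close> of integers in \<open>\<int>\<^sub>r\<close>, meaningful when \<open>b\<close> is a unit of \<open>\<int>\<^sub>r\<close>.\<close>

definition radic_quotient :: "nat \<Rightarrow> int \<Rightarrow> int \<Rightarrow> (nat \<Rightarrow> int)" where
  "radic_quotient r a b =
    radic_of_int r a \<otimes>\<^bsub>radic r\<^esub> inv\<^bsub>radic r\<^esub> (radic_of_int r b)"

section \<open>The maximal equicontinuous factor\<close>

definition mef :: "nat \<Rightarrow> 'a substitution \<Rightarrow> (int \<Rightarrow> 'a) \<Rightarrow> (nat \<Rightarrow> int)" where
  "mef r \<theta> x =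
    (THE z. z \<in> carrier (radic r) \<and>
      (\<forall>n. \<forall>i<r ^ n. z n = int i \<longleftrightarrow>
        x \<in> (shift ^^ i) ` (subst_two_sided r \<theta> ^^ n) ` subst_shift r \<theta>))"

definition kappa :: "nat \<Rightarrow> 'a substitution \<Rightarrow> ((int \<Rightarrow> 'a) \<Rightarrow> (int \<Rightarrow> 'a)) \<Rightarrow> (nat \<Rightarrow> int)" where
  "kappa r \<theta> \<Phi> =
    (THE z. z \<in> carrier (radic r) \<and>
      (\<forall>x\<in>subst_shift r \<theta>. mef r \<theta> (\<Phi> x) = z \<oplus>\<^bsub>radic r\<^esub> mef r \<theta> x))"

section \<open>Dotted words\<close>

text \<open>The letter with index \<open>j\<close> of the word \<open>v \<cdot> w\<close>, in which \<open>w\<close> starts at coordinate \<open>0\<close>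
  and the last letter of \<open>v\<close> has coordinate \<open>- 1\<close>.\<close>

definition dotted_nth :: "'a list \<Rightarrow> 'a list \<Rightarrow> int \<Rightarrow> 'a" where
  "dotted_nth v w j = (if j < 0 then v ! nat (int (length v) + j) else w ! nat j)"

definition subst_dotted_nth :: "'a substitution \<Rightarrow> nat \<Rightarrow> 'a list \<Rightarrow> 'a list \<Rightarrow> int \<Rightarrow> 'a" where
  "subst_dotted_nth \<theta> n v w =
    dotted_nth ((subst_word \<theta> ^^ n) v) ((subst_word \<theta> ^^ n) w)"

end

theory Submission
  imports Defs "HOL-Analysis.T1_Spaces" "HOL-Number_Theory.Cong"
begin

text \<open>Write \<open>c\<close> for the column number. If \<open>\<Phi>\<close> is an automorphism with \<open>\<kappa>(\<Phi>) = k / (1 - r\<^sup>p)\<close>,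
  then so is \<open>\<sigma>\<^sup>k \<theta>\<^sup>p \<Phi> \<theta>\<^bsup>-p\<^esup>\<close>, with the same \<open>\<kappa>\<close>. By minimality an automorphism with given
  \<open>\<kappa>\<close> is determined by the image of one point, and some fibre of \<open>\<pi>\<close> has at most \<open>c\<close> points; hence
  the orbit of \<open>\<Phi>\<close> under this operation closes up after at most \<open>c\<close> steps, and
  \<open>\<Phi> \<theta>\<^bsup>c!p\<^esup> = \<sigma>\<^sup>N \<theta>\<^bsup>c!p\<^esup> \<Phi>\<close>, which is condition (2) read letter by letter.

  Conversely this commutation relation, iterated, spreads condition (1) from words of length two to
  all words, so \<open>\<Phi>\<close> maps \<open>X\<^sub>\<theta>\<close> to itself; it also determines \<open>\<kappa>(\<Phi>)\<close>. Then \<open>\<Phi>\<close> is onto by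
  minimality. It is injective because \<open>\<sigma>\<^sup>k \<Phi>\<^bsup>r^p-1\<^esup>\<close> preserves \<open>\<pi>\<close> and maps each of its finite
  fibres onto itself.\<close>

section \<open>Powers of a substitution\<close>

text \<open>The number \<open>k / (1 - r^p)\<close> is the solution of
  \<open>z = k + r^p * z\<close>, and the operation above changes \<kappa> by exactly
  \<open>z \<mapsto> k + r^p * z\<close>; this is why the orbit of \<Phi> stays over one value. The
  length \<open>d \<le> c\<close> of the cycle depends on \<Phi>, so the factorial, a common
  multiple of all candidates, takes its place, and \<open>N\<close> adds up the shifts of the single
  steps. The obstacle is the inverse of \<theta>: it is defined only on \<theta>(X), so points must
  be cut into blocks up to a shift, and the cut is unambiguous only by recognizability. The same
  fact makes the definite descriptions \<open>mef\<close> and \<open>kappa\<close> meaningful, so it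
  has to be available before any statement about them. The bound \<open>c\<close> on a fibre comes
  from an r-adic integer whose digits repeat one column with few values, a column away from both
  ends of the word. Minimality is used throughout to pass from one point to all: the relations
  involved are local, respect shifts and have closed solution sets.\<close>

definition sh :: "int \<Rightarrow> (int \<Rightarrow> 'a) \<Rightarrow> int \<Rightarrow> 'a" where
  "sh t x = (\<lambda>i. x (i + t))"

lemma sh_0 [simp]: "sh 0 x = x"
  and sh_sh [simp]: "sh s (sh t x) = sh (s + t) x"
  and sh_apply: "sh t x i = x (i + t)"
  by (simp_all add: sh_def add.assoc)

lemma sh_eq_iff: "sh s x = sh t y \<longleftrightarrow> sh (s - t) x = y"
proof
  assume "sh s x = sh t y"
  then have "sh (-t) (sh s x) = sh (-t) (sh t y)"
    by simp
  then show "sh (s - t) x = y"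
    by simp
next
  assume "sh (s - t) x = y"
  then have "sh t (sh (s - t) x) = sh t y"
    by simp
  then show "sh s x = sh t y"
    by simp
qed

lemma shift_eq_sh: "shift = sh 1"
  by (simp add: fun_eq_iff shift_def sh_def)

lemma shift_pow: "(shift ^^ n) x = sh (int n) x"
  by (induction n) (simp_all add: shift_eq_sh add.commute)

text \<open>Basic neighbourhoods of the product topology, by the radius of the window. The radius is
  an integer, and a negative one imposes nothing.\<close>

definition near :: "int \<Rightarrow> (int \<Rightarrow> 'a) \<Rightarrow> (int \<Rightarrow> 'a) \<Rightarrow> bool" where
  "near L x y \<longleftrightarrow> (\<forall>i. \<bar>i\<bar> \<le> L \<longrightarrow> x i = y i)"

lemma near_mono: "near L x y \<Longrightarrow> K \<le> L \<Longrightarrow> near K x y"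
  by (auto simp: near_def)

lemma near_trans: "near L x y \<Longrightarrow> near L y z \<Longrightarrow> near L x z"
  by (auto simp: near_def)

lemma near_sym: "near L x y \<Longrightarrow> near L y x"
  by (auto simp: near_def)

lemma near_sh: "near (L + \<bar>t\<bar>) x y \<Longrightarrow> near L (sh t x) (sh t y)"
  by (auto simp: near_def sh_def)

lemma near_all_eq: "(\<And>L. near L x y) \<Longrightarrow> x = y"
  unfolding near_def by (meson ext order_refl)

text \<open>The letter with index \<open>i\<close> of \<open>\<theta>\<^sup>n(a)\<close>, for \<open>i < r\<^sup>n\<close>.\<close>

fun power_letter :: "nat \<Rightarrow> 'a substitution \<Rightarrow> nat \<Rightarrow> 'a \<Rightarrow> nat \<Rightarrow> 'a" where
  "power_letter r \<theta> 0 a i = a"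
| "power_letter r \<theta> (Suc n) a i = \<theta> (power_letter r \<theta> n a (i div r)) ! (i mod r)"

locale constant_length =
  fixes \<theta> :: "'a::finite substitution" and r :: nat
  assumes has_len: "has_length r \<theta>"
    and inj_\<theta>: "inj \<theta>"
    and r_ge_2: "2 \<le> r"
begin

abbreviation pw :: "nat \<Rightarrow> 'a \<Rightarrow> nat \<Rightarrow> 'a" where
  "pw \<equiv> power_letter r \<theta>"

abbreviation X :: "(int \<Rightarrow> 'a) set" where
  "X \<equiv> subst_shift r \<theta>"

definition sub :: "nat \<Rightarrow> (int \<Rightarrow> 'a) \<Rightarrow> int \<Rightarrow> 'a" where
  "sub n = subst_two_sided r \<theta> ^^ n"

definition ssub :: "nat \<Rightarrow> (nat \<Rightarrow> 'a) \<Rightarrow> nat \<Rightarrow> 'a" where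
  "ssub n = subst_one_sided r \<theta> ^^ n"

abbreviation periodic :: "(nat \<Rightarrow> 'a) \<Rightarrow> bool" where
  "periodic \<equiv> periodic_point r \<theta>"

lemma length_\<theta> [simp]: "length (\<theta> a) = r"
  using has_len by (simp add: has_length_def)

lemma r_pow_pos [simp]: "0 < r ^ n" "0 < r"
  using r_ge_2 by auto

lemma less_r_pow: "n < r ^ n"
  using r_ge_2 by (simp add: less_exp power_strict_increasing_iff less_le_trans[OF less_exp power_mono])

lemma pw_add:
  "pw (m + n) a i = pw n (pw m a (i div r ^ n)) (i mod r ^ n)"
proof (induction n arbitrary: i)
  case (Suc n)
  have "i mod (r * r ^ n) div r = i div r mod r ^ n"
    by (simp add: mod_mult2_eq)
  then show ?case
    by (simp add: Suc div_mult2_eq mod_mod_cancel)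
qed simp

text \<open>The letters at indices \<open>i * r + j\<close> with \<open>j < r\<close> are \<theta>
  of letter \<open>i\<close> one level below, so injectivity of \<theta> removes the outermost
  application.\<close>

lemma pw_inject: "(\<And>i. i < r ^ n \<Longrightarrow> pw n a i = pw n b i) \<Longrightarrow> a = b"
proof (induction n)
  case (Suc n)
  show ?case
  proof (rule Suc.IH)
    fix i assume i: "i < r ^ n"
    have "\<theta> (pw n a i) = \<theta> (pw n b i)"
    proof (rule nth_equalityI)
      fix j assume "j < length (\<theta> (pw n a i))"
      then have j: "j < r"
        by simp
      then have "i * r + j < r ^ n * r"
        using i mult_le_mono1[of "Suc i" "r ^ n" r] by simp
      from Suc.prems[of "i * r + j"] this j show "\<theta> (pw n a i) ! j = \<theta> (pw n b i) ! j"
        by (simp add: mult.commute)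
    qed simp
    then show "pw n a i = pw n b i"
      using inj_\<theta> by (simp add: inj_eq)
  qed
qed simp

lemma sub_0 [simp]: "sub 0 x = x"
  by (simp add: sub_def)

lemma sub_sub [simp]: "sub m (sub n x) = sub (m + n) x"
  by (simp add: sub_def funpow_add)

lemma sub_apply: "sub n x i = pw n (x (i div int r ^ n)) (nat (i mod int r ^ n))"
proof (induction n arbitrary: i)
  case (Suc n)
  have 1: "i mod (int r * int r ^ n) div int r = i div int r mod int r ^ n"
    by (simp add: zmod_zmult2_eq)
  have "nat (i mod (int r * int r ^ n)) div r = nat (i div int r mod int r ^ n)"
    unfolding 1[symmetric] by (simp add: nat_div_distrib)
  moreover have "nat (i mod (int r * int r ^ n)) mod r = nat (i mod int r)"
  proof -
    have "int (nat (i mod (int r * int r ^ n)) mod r) = i mod int r"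
      by (simp add: zmod_int mod_mod_cancel)
    then show ?thesis
      by (metis nat_int)
  qed
  ultimately show ?case
    using Suc[of "i div int r"]
    by (simp add: sub_def subst_two_sided_def zdiv_zmult2_eq)
qed simp

lemma ssub_apply: "ssub n u i = pw n (u (i div r ^ n)) (i mod r ^ n)"
proof (induction n arbitrary: i)
  case (Suc n)
  have "i mod (r * r ^ n) div r = i div r mod r ^ n"
    by (simp add: mod_mult2_eq)
  then show ?case
    using Suc[of "i div r"]
    by (simp add: ssub_def subst_one_sided_def div_mult2_eq mod_mod_cancel)
qed (simp add: ssub_def)

lemma ssub_ssub: "ssub m (ssub n u) = ssub (m + n) u"
  by (simp add: ssub_def funpow_add)

lemma subst_word_length: "length ((subst_word \<theta> ^^ n) w) = r ^ n * length w"
proof (induction n)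
  case (Suc n)
  have "length (subst_word \<theta> v) = r * length v" for v
    by (induction v) (simp_all add: subst_word_def)
  then show ?case
    using Suc by simp
qed simp

lemma subst_word_nth:
  assumes "i < r ^ n * length w"
  shows "(subst_word \<theta> ^^ n) w ! i = pw n (w ! (i div r ^ n)) (i mod r ^ n)"
  using assms
proof (induction n arbitrary: i)
  case (Suc n)
  have 1: "subst_word \<theta> v ! i = \<theta> (v ! (i div r)) ! (i mod r)" if "i < r * length v" for v i
    using that
  proof (induction v arbitrary: i)
    case (Cons a v)
    show ?case
    proof (cases "i < r")
      case True
      then show ?thesis
        by (simp add: subst_word_def nth_append)
    next
      case False
      then have "i = r + (i - r)"
        by simp
      moreover have "i - r < r * length v"
        using Cons.prems False by simp
      ultimately show ?thesis
        using Cons.IH[of "i - r"] False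
        by (simp add: subst_word_def nth_append le_div_geq le_mod_geq)
    qed
  qed simp
  have 2: "i mod (r * r ^ n) div r = i div r mod r ^ n"
    by (simp add: mod_mult2_eq)
  have 3: "i div r < r ^ n * length w"
    using Suc.prems by (simp add: div_less_iff_less_mult mult_ac)
  have "(subst_word \<theta> ^^ Suc n) w ! i = \<theta> ((subst_word \<theta> ^^ n) w ! (i div r)) ! (i mod r)"
    using 1[of i "(subst_word \<theta> ^^ n) w"] Suc.prems by (simp add: subst_word_length mult_ac)
  also have "\<dots> = pw (Suc n) (w ! (i div r ^ Suc n)) (i mod r ^ Suc n)"
    using Suc.IH[OF 3] 2 by (simp add: div_mult2_eq mod_mod_cancel)
  finally show ?case .
qed simp

lemma sub_sh: "sub n (sh t x) = sh (int r ^ n * t) (sub n x)"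
  by (simp add: fun_eq_iff sub_apply sh_def add.commute)

lemma sub_cong: "x (i div int r ^ n) = y (j div int r ^ n) \<Longrightarrow> i mod int r ^ n = j mod int r ^ n
    \<Longrightarrow> sub n x i = sub n y j"
  by (simp add: sub_apply)

lemma sub_inject_at:
  assumes "\<And>s. 0 \<le> s \<Longrightarrow> s < int r ^ n \<Longrightarrow> sub n x (int r ^ n * i + s) = sub n y (int r ^ n * j + s)"
  shows "x i = y j"
proof (rule pw_inject[of n])
  fix s assume s: "s < r ^ n"
  then have "int s < int r ^ n"
    by (metis of_nat_less_iff of_nat_power)
  then show "pw n (x i) s = pw n (y j) s"
    using assms[of "int s"] by (simp add: sub_apply)
qed

lemma sub_inject: "sub n x = sub n y \<longleftrightarrow> x = y"
  using sub_inject_at[of n x _ y] by (auto intro!: ext)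

text \<open>For negative \<open>i\<close> the rounded quotient is still at least \<open>i\<close>.
  Hence a window of \<open>x\<close> determines the window of \<open>sub n x\<close> of the same
  radius, which avoids bookkeeping of radii.\<close>

lemma abs_div_le: "\<bar>i div int r ^ n\<bar> \<le> \<bar>i\<bar>"
proof -
  define q where "q = i div int r ^ n"
  have R: "1 \<le> int r ^ n"
    using r_ge_2 by simp
  have i: "int r ^ n * q \<le> i" "i < int r ^ n * (q + 1)"
    using R pos_mod_bound[of "int r ^ n" i] pos_mod_sign[of "int r ^ n" i]
      mult_div_mod_eq[of "int r ^ n" i]
    by (simp_all add: q_def algebra_simps, linarith+)
  show ?thesis
  proof (cases "0 \<le> q")
    case True
    then have "1 * q \<le> int r ^ n * q"
      using R by (intro mult_right_mono)
    then show ?thesis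
      using i True unfolding q_def[symmetric] by linarith
  next
    case False
    then have "int r ^ n * (q + 1) \<le> 1 * (q + 1)"
      using R by (intro mult_right_mono_neg) auto
    then have "i < q + 1"
      using i(2) by (metis less_le_trans mult_1)
    then show ?thesis
      using False unfolding q_def[symmetric] by linarith
  qed
qed

lemma near_sub: "near L x y \<Longrightarrow> near L (sub n x) (sub n y)"
  unfolding near_def using abs_div_le[of _ n] order_trans by (blast intro: sub_cong)

text \<open>A letter can be decoded once its whole block is visible; the blocks of the indices up to
  \<open>L\<close> end before \<open>r^n * (L + 1)\<close>, whence the extra 1.\<close>

lemma near_sub_inject:
  assumes "near (int r ^ n * (L + 1)) (sub n x) (sub n y)"
  shows "near L x y"
  unfolding near_def
proof (intro allI impI)
  fix i :: int assume i: "\<bar>i\<bar> \<le> L"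
  show "x i = y i"
  proof (rule sub_inject_at)
    fix s assume s: "0 \<le> s" "s < int r ^ n"
    have "\<bar>int r ^ n * i\<bar> \<le> int r ^ n * L"
      using i by (simp add: abs_mult)
    then have "\<bar>int r ^ n * i + s\<bar> \<le> int r ^ n * (L + 1)"
      using s by (simp add: algebra_simps)
    then show "sub n x (int r ^ n * i + s) = sub n y (int r ^ n * i + s)"
      using assms by (simp add: near_def)
  qed
qed

text \<open>Membership by windows in place of words. \<open>m\<close> is the place of coordinate 0
  in the one-sided point, and \<open>L \<le> m\<close> keeps \<open>i + m\<close> nonnegative on the
  window, so that \<open>nat\<close> truncates nothing.\<close>

lemma mem_X_iff:
  "x \<in> X \<longleftrightarrow>
    (\<forall>L::nat. \<exists>v m. periodic v \<and> int L \<le> m \<and> near L x (\<lambda>i. v (nat (i + m))))"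
  (is "_ \<longleftrightarrow> (\<forall>L. ?P L)")
proof
  assume x: "x \<in> X"
  show "\<forall>L. ?P L"
  proof
    fix L :: nat
    define w where "w = map x [- int L..int L]"
    have len: "length w = 2 * L + 1"
      by (simp add: w_def)
    have w: "w ! i = x (int i - int L)" if "i < length w" for i
      using that by (simp add: w_def nth_upto)
    have "occurs_two_sided w x"
      unfolding occurs_two_sided_def using w by (intro exI[of _ "- int L"]) auto
    then obtain u j where u: "periodic u" "\<forall>i<length w. w ! i = u (j + i)"
      using x by (force simp: subst_shift_def occurs_one_sided_def)
    have "near L x (\<lambda>i. u (nat (i + (int j + int L))))"
      unfolding near_def
    proof (intro allI impI)
      fix i :: int assume i: "\<bar>i\<bar> \<le> int L"
      then have "nat (i + int L) < length w"
        by (simp add: len)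
      with u(2) w have "x (int (nat (i + int L)) - int L) = u (j + nat (i + int L))"
        by metis
      moreover have "int (nat (i + int L)) - int L = i" "j + nat (i + int L) = nat (i + (int j + int L))"
        using i by linarith+
      ultimately show "x i = u (nat (i + (int j + int L)))"
        by simp
    qed
    with u(1) show "?P L"
      by (intro exI[of _ u] exI[of _ "int j + int L"]) simp
  qed
next
  assume P: "\<forall>L. ?P L"
  have "\<exists>u. periodic u \<and> occurs_one_sided w u" if "occurs_two_sided w x" for w
  proof -
    from that obtain j where j: "\<forall>i<length w. w ! i = x (j + int i)"
      by (auto simp: occurs_two_sided_def)
    define L where "L = nat \<bar>j\<bar> + length w"
    obtain v m where v: "periodic v" "int L \<le> m" "near L x (\<lambda>i. v (nat (i + m)))"
      using P by blast
    have "w ! i = v (nat (j + m) + i)" if "i < length w" for i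
    proof -
      have "x (j + int i) = v (nat (j + int i + m))"
        using v(3) that by (simp add: near_def L_def)
      moreover have "nat (j + int i + m) = nat (j + m) + i"
        using v(2) that by (simp add: L_def)
      ultimately show ?thesis
        using j that by simp
    qed
    with v(1) show ?thesis
      by (auto simp: occurs_one_sided_def)
  qed
  then show "x \<in> X"
    by (simp add: subst_shift_def)
qed

lemma mem_X_D: "x \<in> X \<Longrightarrow> \<exists>v m. periodic v \<and> L \<le> m \<and> near L x (\<lambda>i. v (nat (i + m)))"
  using mem_X_iff[of x] by (metis int_nat_eq near_mono order_refl order_trans nle_le)

lemma X_closed: "(\<And>L. \<exists>y\<in>X. near L x y) \<Longrightarrow> x \<in> X"
  unfolding mem_X_iff[of x]
proof
  fix L :: nat assume "\<And>L. \<exists>y\<in>X. near L x y"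
  then obtain y where "y \<in> X" "near L x y"
    by blast
  then show "\<exists>v m. periodic v \<and> int L \<le> m \<and> near L x (\<lambda>i. v (nat (i + m)))"
    using mem_X_D[of y "int L"] near_trans by blast
qed

lemma sh_mem_X: "x \<in> X \<Longrightarrow> sh t x \<in> X"
  unfolding mem_X_iff[of "sh t x"]
proof
  fix L :: nat assume "x \<in> X"
  then obtain v m where v: "periodic v" "int L + \<bar>t\<bar> \<le> m" "near (int L + \<bar>t\<bar>) x (\<lambda>i. v (nat (i + m)))"
    using mem_X_D by blast
  then have "near L (sh t x) (\<lambda>i. v (nat (i + (t + m))))"
    using near_sh[OF v(3)] by (simp add: sh_def add_ac)
  then show "\<exists>v m. periodic v \<and> int L \<le> m \<and> near L (sh t x) (\<lambda>i. v (nat (i + m)))"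
    using v by (intro exI[of _ v] exI[of _ "t + m"]) simp
qed

lemma sh_mem_X_iff [simp]: "sh t x \<in> X \<longleftrightarrow> x \<in> X"
  using sh_mem_X[of "sh t x" "-t"] sh_mem_X[of x t] by auto

lemma periodic_iff: "periodic u \<longleftrightarrow> (\<exists>n\<ge>1. ssub n u = u)"
  by (simp add: periodic_point_def ssub_def)

lemma ssub_mult: "ssub q u = u \<Longrightarrow> ssub (q * n) u = u"
  by (induction n) (simp_all add: ssub_ssub[symmetric], simp add: ssub_def)

text \<open>Substitution runs through the orbit of a periodic point cyclically, so
  \<open>q * n - n\<close> steps forward act as \<open>n\<close> steps back.\<close>

lemma periodic_unsub:
  assumes "periodic u"
  obtains v where "periodic v" "u = ssub n v"
proof -
  from assms obtain q where q: "q \<ge> 1" "ssub q u = u"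
    by (auto simp: periodic_iff)
  have le: "n \<le> q * n"
    using q by simp
  define v where "v = ssub (q * n - n) u"
  have "ssub n v = u"
    using ssub_mult[OF q(2), of n] le by (simp add: v_def ssub_ssub)
  moreover have "ssub q v = v"
    unfolding v_def ssub_ssub by (metis add.commute q(2) ssub_ssub)
  ultimately show ?thesis
    using q(1) that[of v] by (auto simp: periodic_iff)
qed

lemma periodic_ssub: "periodic u \<Longrightarrow> periodic (ssub n u)"
  unfolding periodic_iff by (metis add.commute ssub_ssub)

lemma sub_ssub:
  assumes "near L x (\<lambda>i. v (nat (i + m)))" "L \<le> m"
  shows "near L (sub n x) (\<lambda>i. ssub n v (nat (i + int r ^ n * m)))"
  unfolding near_def
proof (intro allI impI)
  fix i :: int assume i: "\<bar>i\<bar> \<le> L"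
  have R: "0 < int r ^ n"
    by simp
  have d: "\<bar>i div int r ^ n\<bar> \<le> L"
    using i abs_div_le[of i n] by simp
  have "0 \<le> i + int r ^ n * m"
  proof -
    have "1 * m \<le> int r ^ n * m"
      using R assms(2) i by (intro mult_right_mono) linarith+
    then show ?thesis
      using i assms(2) by linarith
  qed
  then obtain k where k: "i + int r ^ n * m = int k"
    by (metis nonneg_int_cases)
  then have "int (k div r ^ n) = i div int r ^ n + m" "int (k mod r ^ n) = i mod int r ^ n"
    using R by (simp_all add: zdiv_int zmod_int flip: k)
  then have "nat (i + int r ^ n * m) div r ^ n = nat (i div int r ^ n + m)"
    and "nat (i + int r ^ n * m) mod r ^ n = nat (i mod int r ^ n)"
    by (metis k nat_int)+
  then show "sub n x i = ssub n v (nat (i + int r ^ n * m))"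
    using assms(1) d by (simp add: sub_apply ssub_apply near_def)
qed

lemma sub_mem_X: "x \<in> X \<Longrightarrow> sub n x \<in> X"
  unfolding mem_X_iff[of "sub n x"]
proof
  fix L :: nat assume "x \<in> X"
  then obtain v m where v: "periodic v" "int L \<le> m" "near (int L) x (\<lambda>i. v (nat (i + m)))"
    using mem_X_D by blast
  have "1 * m \<le> int r ^ n * m"
    using v(2) r_ge_2 by (intro mult_right_mono) simp_all
  then show "\<exists>v m. periodic v \<and> int L \<le> m \<and> near L (sub n x) (\<lambda>i. v (nat (i + m)))"
    using v sub_ssub[OF v(3,2)] periodic_ssub[OF v(1)]
    by (intro exI[of _ "ssub n v"] exI[of _ "int r ^ n * m"]) simp
qed

end

section \<open>Minimality and desubstitution\<close>

locale aperiodic_substitution = constant_length +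
  assumes prim: "primitive \<theta>"
    and inf_X: "infinite X"
begin

lemma ex_X: "\<exists>x. x \<in> X"
  using inf_X by (metis equals0I finite.emptyI)

lemma primitive_pw: obtains k where "\<And>a b. \<exists>t<r ^ k. pw k b t = a"
proof -
  obtain k where k: "\<And>a b. b \<in> set ((subst_word \<theta> ^^ k) [a])"
    using prim by (auto simp: primitive_def)
  have "\<exists>t<r ^ k. pw k b t = a" for a b
  proof -
    obtain t where t: "t < length ((subst_word \<theta> ^^ k) [b])" "(subst_word \<theta> ^^ k) [b] ! t = a"
      using k[of a b] by (metis in_set_conv_nth)
    then have "t < r ^ k"
      by (simp add: subst_word_length)
    with t subst_word_nth[of t k "[b]"] show ?thesis
      by (auto simp: subst_word_length)
  qed
  then show ?thesis
    by (rule that)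
qed

text \<open>The window of \<open>x\<close> is read in a periodic \<open>u\<close> fixed by
  \<open>\<theta>^n\<close>, with \<open>n\<close> so large that it lies inside
  \<open>\<theta>^n(u_0)\<close>. The window of \<open>y\<close> of radius \<open>r^(k + n)\<close>
  contains a full block of level \<open>k + n\<close>; by primitivity \<open>\<theta>^k\<close> of
  its letter contains \<open>u_0\<close>, so the block contains
  \<open>\<theta>^n(u_0)\<close>.\<close>

lemma minimal:
  assumes "x \<in> X" "y \<in> X"
  shows "\<exists>m. near L x (sh m y)"
proof -
  obtain u j where u: "periodic u" "\<bar>L\<bar> \<le> j" "near \<bar>L\<bar> x (\<lambda>i. u (nat (i + j)))"
    using mem_X_D[OF assms(1)] by blast
  obtain q where q: "q \<ge> 1" "ssub q u = u"
    using u(1) periodic_iff by blast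
  \<comment> \<open>A multiple of the period \<open>q\<close> that exceeds the last position
    \<open>j + |L|\<close> of the window; \<open>r^n\<close> exceeds \<open>n\<close>.\<close>
  define n where "n = q * (nat (j + \<bar>L\<bar>) + 1)"
  have un: "ssub n u = u"
    using q(2) n_def ssub_mult by blast
  have "nat (j + \<bar>L\<bar>) < n"
    using mult_le_mono1[OF q(1), of "nat (j + \<bar>L\<bar>) + 1"] by (simp add: n_def)
  then have jn: "nat (j + \<bar>L\<bar>) < r ^ n"
    using less_r_pow[of n] by simp
  obtain k where k: "\<And>a b. \<exists>t<r ^ k. pw k b t = a"
    using primitive_pw by blast
  define R where "R = r ^ (k + n)"
  obtain v m where v: "periodic v" "int R \<le> m" "near R y (\<lambda>i. v (nat (i + m)))"
    using mem_X_D[OF assms(2)] by blast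
  obtain v' where v': "v = ssub (k + n) v'"
    using periodic_unsub[OF v(1)] by metis
  \<comment> \<open>Coordinate 0 of \<open>y\<close> lies in block \<open>M\<close> of
    \<open>v\<close> at offset \<open>s\<close>, so this block starts at coordinate
    \<open>-s\<close>.\<close>
  define M where "M = nat m div R"
  define s where "s = nat m mod R"
  have m: "m = int (M * R + s)"
    using v(2) by (simp add: M_def s_def)
  have R0: "R > 0"
    by (simp add: R_def)
  have s: "s < R"
    using R0 by (simp add: s_def)
  obtain t where t: "t < r ^ k" "pw k (v' M) t = u 0"
    using k by blast
  have y: "y (int (t * r ^ n + e) - int s) = pw n (u 0) e" if e: "e < r ^ n" for e
  proof -
    have "t * r ^ n + e < R"
      using mult_le_mono1[of "Suc t" "r ^ k" "r ^ n"] t(1) e by (simp add: R_def power_add)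
    then have "\<bar>int (t * r ^ n + e) - int s\<bar> \<le> int R"
      using s by linarith
    then have "y (int (t * r ^ n + e) - int s) = v (nat (int (t * r ^ n + e) - int s + m))"
      using v(3) unfolding near_def by blast
    also have "nat (int (t * r ^ n + e) - int s + m) = M * R + (t * r ^ n + e)"
      by (simp add: m nat_eq_iff)
    also have "v \<dots> = pw (k + n) (v' M) (t * r ^ n + e)"
      using \<open>t * r ^ n + e < R\<close> by (simp add: v' ssub_apply R_def[symmetric] div_add1_eq[of "M * R"])
    also have "\<dots> = pw n (u 0) e"
      using e t(2) by (simp add: pw_add)
    finally show ?thesis .
  qed
  have "near L x (sh (int (t * r ^ n) + j - int s) y)"
    unfolding near_def
  proof (intro allI impI)
    fix i :: int assume i: "\<bar>i\<bar> \<le> L"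
    define e where "e = nat (i + j)"
    have e: "e < r ^ n" "int e = i + j"
      using i u(2) jn by (auto simp: e_def)
    have "x i = u e"
      using u(3) i by (simp add: near_def e_def)
    also have "\<dots> = pw n (u 0) e"
      using ssub_apply[of n u e] un e(1) by simp
    also have "\<dots> = y (int (t * r ^ n + e) - int s)"
      using y[OF e(1)] by simp
    also have "int (t * r ^ n + e) - int s = i + (int (t * r ^ n) + j - int s)"
      using e(2) by simp
    finally show "x i = sh (int (t * r ^ n) + j - int s) y i"
      by (simp add: sh_def)
  qed
  then show ?thesis
    by blast
qed

text \<open>Injectivity forces the approximate preimages to agree on growing windows, so they
  converge. Stated for arbitrary sequences because \<open>desubstitute_1\<close> applies it to
  one-sided points continued to the left by a constant.\<close>

lemma decode_seq:
  assumes "\<And>L. \<exists>y. near L w (sub n y)"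
  shows "\<exists>y. w = sub n y"
proof -
  obtain Y where Y: "\<And>L. near L w (sub n (Y L))"
    using assms by metis
  define R where "R = int r ^ n"
  have R: "1 \<le> R"
    using r_ge_2 by (simp add: R_def)
  \<comment> \<open>From this radius on, letter \<open>i\<close> of the approximate preimage no
    longer changes.\<close>
  define y where "y i = Y (R * (\<bar>i\<bar> + 1)) i" for i
  have Y_eq: "Y L i = y i" if "R * (\<bar>i\<bar> + 1) \<le> L" for L i
  proof -
    have "near (R * (\<bar>i\<bar> + 1)) (sub n (Y L)) (sub n (Y (R * (\<bar>i\<bar> + 1))))"
      using Y near_mono[OF Y that] near_trans near_sym by blast
    then have "near \<bar>i\<bar> (Y L) (Y (R * (\<bar>i\<bar> + 1)))"
      unfolding R_def by (rule near_sub_inject)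
    then show ?thesis
      by (simp add: near_def y_def)
  qed
  have "w i = sub n y i" for i
  proof -
    define L where "L = R * (\<bar>i\<bar> + 1)"
    have "1 * (\<bar>i\<bar> + 1) \<le> L"
      unfolding L_def using R by (intro mult_right_mono) auto
    then have "w i = sub n (Y L) i"
      using Y[of L] by (simp add: near_def)
    moreover have "Y L (i div R) = y (i div R)"
    proof (rule Y_eq)
      show "R * (\<bar>i div R\<bar> + 1) \<le> L"
        unfolding L_def using abs_div_le[of i n] R by (intro mult_left_mono) (auto simp: R_def)
    qed
    then have "sub n (Y L) i = sub n y i"
      by (intro sub_cong) (simp_all add: R_def)
    ultimately show ?thesis
      by simp
  qed
  then show ?thesis
    by blast
qed

lemma decode:
  assumes "\<And>L. \<exists>y\<in>X. near L w (sub n y)"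
  shows "\<exists>y\<in>X. w = sub n y"
proof -
  obtain y where y: "w = sub n y"
    using decode_seq assms by meson
  have "y \<in> X"
  proof (rule X_closed)
    fix L
    show "\<exists>z\<in>X. near L y z"
      using assms[of "int r ^ n * (L + 1)"] near_sub_inject unfolding y by blast
  qed
  with y show ?thesis
    by blast
qed

text \<open>A map that turns \<open>sh m\<close> into \<open>sh (r^n * m)\<close> keeps its values
  in the image of \<open>sub n\<close> along the orbit of \<open>x0\<close>. This orbit is dense by
  minimality, and the image of \<open>X\<close> under \<open>sub n\<close> is closed by
  \<open>decode\<close>.\<close>

lemma transfer_decode:
  assumes "x0 \<in> X" "y0 \<in> X" "\<Psi> x0 = sub n y0" "x \<in> X"
    and local: "\<And>L. \<exists>K. \<forall>x y. near K x y \<longrightarrow> near L (\<Psi> x) (\<Psi> y)"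
    and shift: "\<And>m x. \<Psi> (sh m x) = sh (int r ^ n * m) (\<Psi> x)"
  shows "\<exists>y\<in>X. \<Psi> x = sub n y"
proof (rule decode)
  fix L
  obtain K where K: "\<And>x y. near K x y \<Longrightarrow> near L (\<Psi> x) (\<Psi> y)"
    using local by blast
  obtain m where "near K x (sh m x0)"
    using minimal assms(1,4) by blast
  then have "near L (\<Psi> x) (\<Psi> (sh m x0))"
    by (rule K)
  also have "\<Psi> (sh m x0) = sub n (sh m y0)"
    by (simp add: shift assms(3) sub_sh)
  finally show "\<exists>y\<in>X. near L (\<Psi> x) (sub n y)"
    using assms(2) by (intro bexI[of _ "sh m y0"]) simp_all
qed

lemma transfer_sh_sub:
  assumes "x0 \<in> X" "y0 \<in> X" "sh t (sub n x0) = sub n y0" "x \<in> X"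
  shows "\<exists>y\<in>X. sh t (sub n x) = sub n y"
proof (rule transfer_decode[OF assms(1,2) _ assms(4)])
  show "sh t (sub n x0) = sub n y0"
    by fact
  show "\<exists>K. \<forall>x y. near K x y \<longrightarrow> near L (sh t (sub n x)) (sh t (sub n y))" for L
    using near_sh near_sub by blast
  show "sh t (sub n (sh m x)) = sh (int r ^ n * m) (sh t (sub n x))" for m x
    by (simp add: sub_sh add.commute)
qed

text \<open>Pigeonhole over the cutting points modulo \<open>r\<close>: if every phase
  \<open>t\<close> failed at some radius \<open>f t\<close>, a window larger than all these radii
  could not be cut, although it is read in a periodic point, which is itself substituted.\<close>

lemma desubstitute_phase:
  assumes "x \<in> X"
  shows "\<exists>t. \<forall>L. \<exists>v m. periodic v \<and> L \<le> m \<and> near L x (\<lambda>i. ssub 1 v (nat (i + (t + int r * m))))"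
    (is "\<exists>t. \<forall>L. ?P t L")
proof (rule ccontr)
  assume "\<not> ?thesis"
  then obtain f where f: "\<And>t. \<not> ?P t (f t)"
    by metis
  \<comment> \<open>A common bound for the \<open>r\<close> radii; only residues modulo
    \<open>r\<close> occur as phases.\<close>
  define L where "L = (\<Sum>t\<in>{0..<int r}. \<bar>f t\<bar>)"
  have L0: "0 \<le> L"
    by (simp add: L_def sum_nonneg)
  obtain u m where u: "periodic u" "int r * (L + 1) \<le> m" "near (int r * (L + 1)) x (\<lambda>i. u (nat (i + m)))"
    using mem_X_D[OF assms] by blast
  obtain v where v: "periodic v" "u = ssub 1 v"
    using periodic_unsub[OF u(1)] by metis
  define t where "t = m mod int r"
  have t: "t \<in> {0..<int r}"
    by (simp add: t_def)
  then have fL: "f t \<le> L"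
    unfolding L_def using member_le_sum[of t "{0..<int r}" "\<lambda>t. \<bar>f t\<bar>"] by simp
  have "L < m div int r"
    using zdiv_mono1[OF u(2), of "int r"] by simp
  moreover have "near (f t) x (\<lambda>i. ssub 1 v (nat (i + (t + int r * (m div int r)))))"
  proof -
    have "1 * (L + 1) \<le> int r * (L + 1)"
      using L0 r_ge_2 by (intro mult_right_mono) auto
    then show ?thesis
      using near_mono[OF u(3), of "f t"] fL by (simp add: v(2) t_def)
  qed
  ultimately show False
    using f[of t] v(1) fL by (metis less_imp_le order_trans)
qed

lemma desubstitute_1:
  assumes "x \<in> X"
  shows "\<exists>t. \<exists>y\<in>X. x = sh t (sub 1 y)"
proof -
  obtain t where t: "\<And>L. \<exists>v m. periodic v \<and> L \<le> m \<and> near L x (\<lambda>i. ssub 1 v (nat (i + (t + int r * m))))"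
    using desubstitute_phase[OF assms] by blast
  define w where "w = sh (- t) x"
  have w: "\<exists>v m. periodic v \<and> L \<le> m \<and> near L w (sub 1 (\<lambda>i. v (nat (i + m))))" for L
  proof -
    obtain v m where v: "periodic v" "L + \<bar>t\<bar> \<le> m"
        "near (L + \<bar>t\<bar>) x (\<lambda>i. ssub 1 v (nat (i + (t + int r * m))))"
      using t by blast
    have "near L w (\<lambda>i. ssub 1 v (nat (i + int r * m)))"
      using near_sh[of L "-t"] v(3) by (fastforce simp: w_def sh_def)
    moreover have "near L (sub 1 (\<lambda>i. v (nat (i + m)))) (\<lambda>i. ssub 1 v (nat (i + int r * m)))"
      using sub_ssub[of L "\<lambda>i. v (nat (i + m))" v m 1] v(2) by (simp add: near_def)
    ultimately show ?thesis
      using v(1,2) near_trans near_sym by (intro exI[of _ v] exI[of _ m]) fastforce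
  qed
  then obtain y where y: "w = sub 1 y"
    using decode_seq by meson
  have "y \<in> X"
    unfolding mem_X_iff
  proof
    fix L :: nat
    obtain v m where v: "periodic v" "int r ^ 1 * (int L + 1) \<le> m"
      "near (int r ^ 1 * (int L + 1)) w (sub 1 (\<lambda>i. v (nat (i + m))))"
      using w by blast
    have "near L y (\<lambda>i. v (nat (i + m)))"
      using near_sub_inject v(3) unfolding y by blast
    moreover have "1 * (int L + 1) \<le> int r ^ 1 * (int L + 1)"
      using r_ge_2 by (intro mult_right_mono) auto
    ultimately show "\<exists>v m. periodic v \<and> int L \<le> m \<and> near L y (\<lambda>i. v (nat (i + m)))"
      using v(1) order_trans[OF \<open>1 * (int L + 1) \<le> _\<close> v(2)] by (intro exI[of _ v] exI[of _ m]) auto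
  qed
  moreover have "x = sh t (sub 1 y)"
    unfolding y[symmetric] by (simp add: w_def)
  ultimately show ?thesis
    by blast
qed

lemma desubstitute: "x \<in> X \<Longrightarrow> \<exists>t. \<exists>y\<in>X. x = sh t (sub n y)"
proof (induction n arbitrary: x)
  case 0
  then show ?case
    by (intro exI[of _ 0] bexI[of _ x]) simp_all
next
  case (Suc n)
  then obtain t y where "y \<in> X" "x = sh t (sub n y)"
    by blast
  moreover obtain s z where "z \<in> X" "y = sh s (sub 1 z)"
    using desubstitute_1 \<open>y \<in> X\<close> by blast
  ultimately show ?case
    by (auto simp: sub_sh)
qed

section \<open>Recognizability\<close>

text \<open>Desubstituting the image at level \<open>n\<close> gives a translation by
  \<open>j^n - r^n * a\<close> at level \<open>n + 1\<close>, with \<open>a\<close> unknown. Applied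
  \<open>j\<close> times it becomes \<open>j^(n + 1) - r^n * (a * j)\<close>. This error can be
  removed, because \<open>a * j\<close> is a multiple of \<open>j\<close> and such translations are
  already possible at level one.\<close>

lemma sh_power_invariant:
  fixes j :: nat
  assumes "x0 \<in> X" "y0 \<in> X" "sh j (sub 1 x0) = sub 1 y0" "x \<in> X"
  shows "\<exists>y\<in>X. sh (int j ^ n) (sub n x) = sub n y"
  using assms(4)
proof (induction n arbitrary: x)
  case 0
  then show ?case
    by simp
next
  case (Suc n)
  have base: "\<exists>y\<in>X. sh (int q * j) (sub 1 x) = sub 1 y" if "x \<in> X" for q x
  proof (induction q)
    case 0
    then show ?case
      using that by auto
  next
    case (Suc q)
    then obtain y where y: "y \<in> X" "sh (int q * j) (sub 1 x) = sub 1 y"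
      by blast
    obtain z where z: "z \<in> X" "sh j (sub 1 y) = sub 1 z"
      using transfer_sh_sub[OF assms(1-3) y(1)] by blast
    have "sh (int (Suc q) * j) (sub 1 x) = sh j (sh (int q * j) (sub 1 x))"
      by (simp add: algebra_simps)
    then show ?case
      using y z by metis
  qed
  \<comment> \<open>A shift by a multiple of \<open>r\<close> stays inside the image of
    \<open>sub 1\<close>, so \<open>q\<close> can be reduced modulo \<open>r\<close> and in
    particular made nonnegative.\<close>
  have base': "\<exists>y\<in>X. sh (q * int j) (sub 1 x) = sub 1 y" if x: "x \<in> X" for q x
  proof -
    have q: "q * int j = int (nat (q mod int r)) * j + int r * (q div int r * j)"
    proof -
      have "q * int j = (q mod int r + int r * (q div int r)) * j"
        by simp
      then show ?thesis
        by (simp only: distrib_right) (simp add: mult.assoc)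
    qed
    obtain y where y: "y \<in> X" "sh (int (nat (q mod int r)) * j) (sub 1 (sh (q div int r * j) x)) = sub 1 y"
      using base sh_mem_X[OF x] by blast
    then show ?thesis
      unfolding q by (auto simp: sub_sh)
  qed
  obtain z where z: "z \<in> X" "sh (int j ^ n) (sub n (sub 1 x0)) = sub n z"
    using Suc.IH[of "sub 1 x0"] assms(1) sub_mem_X by blast
  obtain a z' where z': "z' \<in> X" "z = sh a (sub 1 z')"
    using desubstitute_1[OF z(1)] by blast
  have x0': "sh (int j ^ n - int r ^ n * a) (sub (Suc n) x0) = sub (Suc n) z'"
    using z(2) unfolding z'(2) by (simp add: sub_sh sh_eq_iff)
  have iter: "\<exists>y\<in>X. sh (int q * (int j ^ n - int r ^ n * a)) (sub (Suc n) x) = sub (Suc n) y"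
    if "x \<in> X" for q x
    using that
  proof (induction q arbitrary: x)
    case 0
    then show ?case
      by auto
  next
    case (Suc q)
    then obtain y where y: "y \<in> X"
        "sh (int q * (int j ^ n - int r ^ n * a)) (sub (Suc n) x) = sub (Suc n) y"
      by blast
    obtain z where z: "z \<in> X" "sh (int j ^ n - int r ^ n * a) (sub (Suc n) y) = sub (Suc n) z"
      using transfer_sh_sub[OF assms(1) z'(1) x0' y(1)] by blast
    have "sh (int (Suc q) * (int j ^ n - int r ^ n * a)) (sub (Suc n) x) =
        sh (int j ^ n - int r ^ n * a) (sh (int q * (int j ^ n - int r ^ n * a)) (sub (Suc n) x))"
      by (simp add: algebra_simps)
    then show ?case
      using y z by auto
  qed
  obtain y where y: "y \<in> X"
      "sh (int j * (int j ^ n - int r ^ n * a)) (sub (Suc n) x) = sub (Suc n) y"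
    using iter[OF Suc.prems, of j] by metis
  obtain z where z: "z \<in> X" "sh (a * j) (sub 1 y) = sub 1 z"
    using base'[OF y(1), of a] by metis
  have "sh (int j ^ Suc n) (sub (Suc n) x) = sh (int r ^ n * (a * j)) (sub (Suc n) y)"
    unfolding sh_eq_iff y(2)[symmetric] by (simp add: algebra_simps)
  also have "\<dots> = sub n (sh (a * j) (sub 1 y))"
    by (simp add: sub_sh)
  also have "\<dots> = sub (Suc n) z"
    unfolding z(2) by simp
  finally show ?case
    using z(1) by blast
qed

text \<open>If \<open>\<theta>(X)\<close> met \<open>\<sigma>\<^sup>j \<theta>(X)\<close> for some \<open>0 < j < r\<close>, then
  \<open>\<theta>\<^bsup>-n\<^esup> \<sigma>\<^bsup>j^n\<^esup> \<theta>\<^sup>n\<close> would be, for every \<open>n\<close>, a block map on \<open>X\<close> with window of width two.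
  There are finitely many of these, yet this map is a translation by the fraction \<open>(j/r)\<^sup>n\<close>:
  its power with exponent \<open>r\<^sup>n\<close> is \<open>\<sigma>\<^bsup>j^n\<^esup>\<close>.\<close>

lemma recognizable_1:
  assumes x0: "x0 \<in> X" and y0: "y0 \<in> X" and eq: "sh (int j) (sub 1 x0) = sub 1 y0"
    and j: "0 < j" "j < r"
  shows False
proof -
  \<comment> \<open>The letter whose image is the window at offset \<open>j^n\<close> in the blocks
    of \<open>a\<close> and \<open>b\<close>; where there is no such letter the value is arbitrary.
    Two blocks suffice since \<open>j^n \<le> r^n\<close>.\<close>
  define F where "F n a b = (SOME c. \<forall>s<r ^ n. pw n c s =
      (if s + j ^ n < r ^ n then pw n a (s + j ^ n) else pw n b (s + j ^ n - r ^ n)))" for n a b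
  define E where "E F x = (\<lambda>i::int. F (x i) (x (i + 1)) :: 'a)" for F :: "'a \<Rightarrow> 'a \<Rightarrow> 'a" and x
  have E: "E (F n) x \<in> X \<and> sub n (E (F n) x) = sh (int j ^ n) (sub n x)" if x: "x \<in> X" for n x
  proof -
    obtain y where y: "y \<in> X" "sh (int j ^ n) (sub n x) = sub n y"
      using sh_power_invariant[OF x0 y0 eq x] by blast
    have jn: "j ^ n \<le> r ^ n"
      using j by (simp add: power_mono)
    have P: "pw n (y i) s =
      (if s + j ^ n < r ^ n then pw n (x i) (s + j ^ n) else pw n (x (i + 1)) (s + j ^ n - r ^ n))"
      if s: "s < r ^ n" for s i
    proof -
      have R: "int r ^ n = int (r ^ n)"
        by simp
      have "pw n (y i) s = sub n y (int (r ^ n) * i + int s)"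
        using s unfolding sub_apply R by simp
      also have "\<dots> = sub n x (int (r ^ n) * i + int (s + j ^ n))"
        by (simp flip: y(2) add: sh_def add.assoc)
      also have "\<dots> =
        (if s + j ^ n < r ^ n then pw n (x i) (s + j ^ n) else pw n (x (i + 1)) (s + j ^ n - r ^ n))"
      proof (cases "s + j ^ n < r ^ n")
        case True
        then show ?thesis
          unfolding sub_apply R by (simp del: of_nat_add of_nat_power)
      next
        case False
        define e where "e = s + j ^ n - r ^ n"
        have e: "int (r ^ n) * i + int (s + j ^ n) = int (r ^ n) * (i + 1) + int e" "e < r ^ n"
          using False s jn by (auto simp: e_def algebra_simps)
        show ?thesis
          unfolding sub_apply R e(1) using False e(2) by (simp add: e_def[symmetric] del: of_nat_power)
      qed
      finally show ?thesis .
    qed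
    have "F n (x i) (x (i + 1)) = y i" for i
    proof -
      have "\<forall>s<r ^ n. pw n (F n (x i) (x (i + 1))) s =
        (if s + j ^ n < r ^ n then pw n (x i) (s + j ^ n) else pw n (x (i + 1)) (s + j ^ n - r ^ n))"
        unfolding F_def by (rule someI[of _ "y i"]) (use P in blast)
      then have "pw n (F n (x i) (x (i + 1))) s = pw n (y i) s" if "s < r ^ n" for s
        using that by (simp only: P)
      then show ?thesis
        by (rule pw_inject)
    qed
    then have "E (F n) x = y"
      by (simp add: E_def)
    then show ?thesis
      using y by simp
  qed
  \<comment> \<open>The maps \<open>F n\<close> belong to a finite type, that of binary maps on the
    alphabet.\<close>
  have "\<not> inj F"
    using finite_imageD[of F UNIV] by auto
  then obtain m n where mn: "n < m" "F m = F n"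
    unfolding inj_def by (metis linorder_neqE_nat)
  define G where "G = E (F n)"
  have G: "(G ^^ q) x \<in> X \<and> sub n ((G ^^ q) x) = sh (int q * int j ^ n) (sub n x)
      \<and> sub m ((G ^^ q) x) = sh (int q * int j ^ m) (sub m x)" if x: "x \<in> X" for q x
  proof (induction q)
    case (Suc q)
    then show ?case
      using E[of "(G ^^ q) x" n] E[of "(G ^^ q) x" m] mn(2) by (simp add: G_def algebra_simps)
  qed (use x in simp)
  have Gn: "(G ^^ (r ^ n)) x = sh (int j ^ n) x" if "x \<in> X" for x
    using G[OF that, of "r ^ n"] by (simp flip: sub_sh add: sub_inject)
  have Gm: "(G ^^ (r ^ m)) x = sh (int j ^ m) x" if "x \<in> X" for x
    using G[OF that, of "r ^ m"] by (simp flip: sub_sh add: sub_inject)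
  have Gq: "((G ^^ (r ^ n)) ^^ q) x = sh (int q * int j ^ n) x" if x: "x \<in> X" for q x
    by (induction q) (use x Gn in \<open>simp_all add: algebra_simps\<close>)
  \<comment> \<open>\<open>G\<close> acts as translation by \<open>(j/r)^n\<close> and also by
    \<open>(j/r)^m\<close>. \<open>P\<close> is the difference of the two fractions times
    \<open>r^m\<close>, and it becomes a period of every point.\<close>
  define P where "P = int r ^ (m - n) * int j ^ n - int j ^ m"
  have "int j ^ m = int j ^ (m - n) * int j ^ n"
    using mn(1) by (simp flip: power_add)
  moreover have "int j ^ (m - n) < int r ^ (m - n)"
    using mn(1) j by (intro power_strict_mono) auto
  ultimately have P0: "0 < P"
    using j by (simp add: P_def)
  have period: "sh P x = x" if x: "x \<in> X" for x
  proof -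
    have "sh (int j ^ m) x = ((G ^^ (r ^ n)) ^^ (r ^ (m - n))) x"
      using Gm[OF x] mn(1) by (simp add: funpow_mult flip: power_add)
    also have "\<dots> = sh (int r ^ (m - n) * int j ^ n) x"
      using Gq[OF x] by simp
    finally show ?thesis
      unfolding P_def by (metis sh_eq_iff)
  qed
  have period': "sh (P * int q) x = x" if x: "x \<in> X" for q x
  proof (induction q)
    case (Suc q)
    have "sh (P * int (Suc q)) x = sh P (sh (P * int q) x)"
      by (simp add: algebra_simps)
    then show ?case
      using Suc period[OF x] by simp
  qed simp
  have period'': "sh t x = sh (t mod P) x" if x: "x \<in> X" for t x
  proof -
    have "sh (P * (t div P)) x = x"
    proof (cases "0 \<le> t div P")
      case True
      then show ?thesis
        using period'[OF x, of "nat (t div P)"] by simp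
    next
      case False
      then have "sh (- (P * (t div P))) x = x"
        using period'[OF x, of "nat (- (t div P))"] by simp
      then show ?thesis
        using sh_eq_iff[of 0 x "P * (t div P)" x] by simp
    qed
    then have "sh (t mod P) (sh (P * (t div P)) x) = sh (t mod P) x"
      by simp
    then show ?thesis
      by simp
  qed
  have sh_mod: "x t = x (t mod P)" if x: "x \<in> X" for t x
    using arg_cong[OF period''[OF x, of t], of "\<lambda>y. y 0"] by (simp add: sh_def)
  \<comment> \<open>A window of radius \<open>P\<close> contains a full period and so determines the
    point; \<open>P\<close> translates of \<open>x0\<close> would exhaust \<open>X\<close>.\<close>
  have "X \<subseteq> (\<lambda>m. sh m x0) ` {0..<P}"
  proof
    fix x assume x: "x \<in> X"
    obtain m where m: "near P x (sh m x0)"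
      using minimal x x0 by blast
    have "x i = sh m x0 i" for i
    proof -
      have "\<bar>i mod P\<bar> \<le> P"
        using P0 by (simp add: less_imp_le)
      then have "x (i mod P) = sh m x0 (i mod P)"
        using m by (simp add: near_def)
      then show ?thesis
        using sh_mod[OF x, of i] sh_mod[of "sh m x0" i] x0 by simp
    qed
    then have "x = sh (m mod P) x0"
      using period''[OF x0, of m] by auto
    then show "x \<in> (\<lambda>m. sh m x0) ` {0..<P}"
      using P0 by auto
  qed
  then show False
    using inf_X finite_subset by blast
qed

text \<open>One application of \<theta> is removed at a time: the remainder of \<open>d\<close>
  modulo \<open>r\<close> vanishes by \<open>recognizable_1\<close>, and the quotient is treated at
  level \<open>n\<close>.\<close>

lemma recognizable:
  assumes "x \<in> X" "y \<in> X" "sh d (sub n x) = sub n y"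
  shows "\<exists>q. d = int r ^ n * q \<and> sh q x = y"
  using assms
proof (induction n arbitrary: d)
  case (Suc n)
  define q j where "q = d div int r" and "j = d mod int r"
  have d: "d = int r * q + j" and j: "0 \<le> j" "j < int r"
    by (simp_all add: q_def j_def)
  have *: "sh j (sub 1 (sh q (sub n x))) = sub 1 (sub n y)"
    using Suc.prems by (simp add: d sub_sh add.commute)
  have "j = 0"
  proof (rule ccontr)
    assume "j \<noteq> 0"
    then show False
      using recognizable_1[of "sh q (sub n x)" "sub n y" "nat j"] * j Suc.prems sub_mem_X
      by (simp add: nat_less_iff)
  qed
  then have "sh q (sub n x) = sub n y"
    using * by (simp only: sh_0 sub_inject)
  then obtain s where "q = int r ^ n * s" "sh s x = y"
    using Suc by blast
  then show ?case
    by (intro exI[of _ s]) (simp add: d \<open>j = 0\<close> mult.assoc)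
qed simp

end

section \<open>The odometer factor\<close>

lemma radic_carrier_iff:
  "z \<in> carrier (radic r) \<longleftrightarrow> (\<forall>n. 0 \<le> z n \<and> z n < int r ^ n \<and> z (Suc n) mod int r ^ n = z n)"
  by (auto simp: radic_def)

lemma radic_eqI:
  assumes "y \<in> carrier (radic r)" "z \<in> carrier (radic r)" "\<And>n. [y n = z n] (mod int r ^ n)"
  shows "y = z"
  using assms by (auto simp: radic_carrier_iff fun_eq_iff cong_def)

lemma radic_mod_carrier:
  assumes "r > 0" "\<And>n. [f (Suc n) = f n] (mod int r ^ n)"
  shows "(\<lambda>n. f n mod int r ^ n) \<in> carrier (radic r)"
  using assms by (auto simp: radic_carrier_iff cong_def mod_mod_cancel)

text \<open>The inverse is the geometric series, cut off after \<open>n\<close> terms at level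
  \<open>n\<close>: the error \<open>r^(p * n)\<close> vanishes modulo \<open>r^n\<close>. As
  \<open>inv\<close> is a description, uniqueness is shown too, by evaluating
  \<open>y * b * v\<close>.\<close>

lemma radic_inverse_one_minus_power:
  assumes r: "r > 0" and p: "1 \<le> p"
  defines "b \<equiv> 1 - int r ^ p"
  defines "v \<equiv> (\<lambda>n. (\<Sum>i<n. int r ^ (p * i)) mod int r ^ n)"
  shows "inv\<^bsub>radic r\<^esub> (radic_of_int r b) = v" and "[b * v n = 1] (mod int r ^ n)"
proof -
  have dvd: "int r ^ n dvd int r ^ (p * n)" for n
    using p by (intro le_imp_power_dvd) simp
  have bv: "[b * v n = 1] (mod int r ^ n)" for n
  proof -
    have "b * (\<Sum>i<n. int r ^ (p * i)) = 1 - int r ^ (p * n)"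
      using one_diff_power_eq[of "int r ^ p" n] by (simp add: b_def power_mult)
    then have "[b * v n = 1 - int r ^ (p * n)] (mod int r ^ n)"
      by (simp add: v_def cong_def mod_mult_right_eq)
    also have "[1 - int r ^ (p * n) = 1 - 0] (mod int r ^ n)"
      using dvd by (intro cong_diff) (simp_all add: cong_0_iff)
    finally show ?thesis
      by simp
  qed
  then show "[b * v n = 1] (mod int r ^ n)" .
  have v: "v \<in> carrier (radic r)"
    unfolding v_def
  proof (rule radic_mod_carrier[OF r])
    show "[(\<Sum>i<Suc n. int r ^ (p * i)) = (\<Sum>i<n. int r ^ (p * i))] (mod int r ^ n)" for n
      using dvd by (simp add: cong_iff_dvd_diff)
  qed
  show "inv\<^bsub>radic r\<^esub> (radic_of_int r b) = v"
    unfolding m_inv_def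
  proof (rule the_equality)
    show "v \<in> carrier (radic r) \<and> radic_of_int r b \<otimes>\<^bsub>radic r\<^esub> v = \<one>\<^bsub>radic r\<^esub> \<and>
        v \<otimes>\<^bsub>radic r\<^esub> radic_of_int r b = \<one>\<^bsub>radic r\<^esub>"
      using v bv by (simp add: radic_def radic_of_int_def fun_eq_iff cong_def mod_mult_left_eq mod_mult_right_eq mult.commute)
    fix y
    assume y: "y \<in> carrier (radic r) \<and> radic_of_int r b \<otimes>\<^bsub>radic r\<^esub> y = \<one>\<^bsub>radic r\<^esub> \<and>
        y \<otimes>\<^bsub>radic r\<^esub> radic_of_int r b = \<one>\<^bsub>radic r\<^esub>"
    have by1: "[b * y n = 1] (mod int r ^ n)" for n
      using y by (simp add: radic_def radic_of_int_def fun_eq_iff cong_def mod_mult_left_eq)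
    show "y = v"
    proof (rule radic_eqI)
      fix n
      have "[y n * (b * v n) = y n * 1] (mod int r ^ n)"
        using bv by (intro cong_mult) auto
      moreover have "[v n * (b * y n) = v n * 1] (mod int r ^ n)"
        using by1 by (intro cong_mult) auto
      ultimately show "[y n = v n] (mod int r ^ n)"
        by (metis (no_types, opaque_lifting) cong_sym cong_trans mult.commute mult.left_commute mult.right_neutral)
    qed (use y v in auto)
  qed
qed

text \<open>Replaces the quotient by a linear congruence at each level, the only form in which it
  enters the dynamics.\<close>

lemma radic_quotient_one_minus_power:
  assumes r: "r > 0" and p: "1 \<le> p"
  shows "radic_quotient r k (1 - int r ^ p) \<in> carrier (radic r)"
    and "z \<in> carrier (radic r) \<Longrightarrow> z = radic_quotient r k (1 - int r ^ p) \<longleftrightarrow>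
      (\<forall>n. [z n * (1 - int r ^ p) = k] (mod int r ^ n))"
proof -
  define b where "b = 1 - int r ^ p"
  define v where "v n = (\<Sum>i<n. int r ^ (p * i)) mod int r ^ n" for n
  have v: "inv\<^bsub>radic r\<^esub> (radic_of_int r b) = v" and bv: "[b * v n = 1] (mod int r ^ n)" for n
    using radic_inverse_one_minus_power[OF r p] by (simp_all add: b_def v_def[abs_def])
  define q where "q = radic_quotient r k b"
  have q: "q = (\<lambda>n. (k * v n) mod int r ^ n)"
    unfolding q_def radic_quotient_def v by (simp add: radic_def radic_of_int_def mod_mult_left_eq)
  have dvd: "int r ^ n dvd int r ^ (p * n)" for n
    using p by (intro le_imp_power_dvd) simp
  have vv: "[v (Suc n) = v n] (mod int r ^ n)" for n
    using dvd by (simp add: v_def cong_def mod_mod_cancel) (metis add.right_neutral dvd_imp_mod_0 mod_add_right_eq)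
  show qc: "radic_quotient r k (1 - int r ^ p) \<in> carrier (radic r)"
    unfolding b_def[symmetric] q_def[symmetric] unfolding q
    by (rule radic_mod_carrier[OF r]) (intro cong_mult vv cong_refl)
  assume z: "z \<in> carrier (radic r)"
  have "z = q \<longleftrightarrow> (\<forall>n. [z n * b = k] (mod int r ^ n))"
  proof (intro iffI allI)
    fix n assume zq: "z = q"
    have "[k * v n * b = k * 1] (mod int r ^ n)"
      unfolding mult.assoc using bv[of n] by (intro cong_mult) (simp_all add: mult.commute)
    then show "[z n * b = k] (mod int r ^ n)"
      by (simp add: zq q cong_def mod_mult_left_eq)
  next
    assume *: "\<forall>n. [z n * b = k] (mod int r ^ n)"
    show "z = q"
    proof (rule radic_eqI[OF z])
      show "q \<in> carrier (radic r)"
        using qc by (simp add: q_def b_def)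
      fix n
      have "[z n * (b * v n) = z n * 1] (mod int r ^ n)"
        using bv by (intro cong_mult) auto
      moreover have "[z n * b * v n = k * v n] (mod int r ^ n)"
        using * by (intro cong_mult) auto
      ultimately have "[z n = k * v n] (mod int r ^ n)"
        by (metis cong_sym cong_trans mult.assoc mult.right_neutral)
      then show "[z n = q n] (mod int r ^ n)"
        by (simp add: q cong_def)
    qed
  qed
  then show "z = radic_quotient r k (1 - int r ^ p) \<longleftrightarrow>
      (\<forall>n. [z n * (1 - int r ^ p) = k] (mod int r ^ n))"
    by (simp add: q_def b_def)
qed

text \<open>Block maps without their local rule. Comparing windows around two different positions
  \<open>i\<close> and \<open>j\<close> expresses continuity and commutation with the shift at
  once.\<close>

definition sliding :: "((int \<Rightarrow> 'a) \<Rightarrow> (int \<Rightarrow> 'b)) \<Rightarrow> bool" where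
  "sliding \<Phi> \<longleftrightarrow>
    (\<exists>K. \<forall>x y i j. (\<forall>t. \<bar>t\<bar> \<le> K \<longrightarrow> x (i + t) = y (j + t)) \<longrightarrow> \<Phi> x i = \<Phi> y j)"

lemma sliding_sh:
  assumes "sliding \<Phi>"
  shows "\<Phi> (sh t x) = sh t (\<Phi> x)"
proof
  fix i
  obtain K where "\<And>x y i j. (\<forall>t. \<bar>t\<bar> \<le> K \<longrightarrow> x (i + t) = y (j + t)) \<Longrightarrow> \<Phi> x i = \<Phi> y j"
    using assms by (auto simp: sliding_def)
  then have "\<Phi> (sh t x) i = \<Phi> x (i + t)"
    by (simp add: sh_def add_ac)
  then show "\<Phi> (sh t x) i = sh t (\<Phi> x) i"
    by (simp add: sh_def)
qed

lemma sliding_near: "sliding \<Phi> \<Longrightarrow> \<exists>K. \<forall>L x y. near (L + K) x y \<longrightarrow> near L (\<Phi> x) (\<Phi> y)"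
proof -
  assume "sliding \<Phi>"
  then obtain K where K: "\<And>x y i j. (\<forall>t. \<bar>t\<bar> \<le> K \<longrightarrow> x (i + t) = y (j + t)) \<Longrightarrow> \<Phi> x i = \<Phi> y j"
    by (auto simp: sliding_def)
  have "near L (\<Phi> x) (\<Phi> y)" if "near (L + K) x y" for L x y
    using that unfolding near_def by (auto intro!: K)
  then show ?thesis
    by blast
qed

lemma sliding_block_map: "sliding (block_map m n f)"
  unfolding sliding_def
proof (intro exI[of _ "int m + int n"] allI impI)
  fix x y :: "int \<Rightarrow> 'a" and i j
  assume *: "\<forall>t. \<bar>t\<bar> \<le> int m + int n \<longrightarrow> x (i + t) = y (j + t)"
  have "map x [i - int m..i + int n] = map y [j - int m..j + int n]"
  proof (rule nth_equalityI)
    fix k assume "k < length (map x [i - int m..i + int n])"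
    then have k: "int k \<le> int n + int m"
      by simp
    then have "x (i + (int k - int m)) = y (j + (int k - int m))"
      using * by auto
    then show "map x [i - int m..i + int n] ! k = map y [j - int m..j + int n] ! k"
      using k by (simp add: nth_upto add_diff_eq diff_add_eq)
  qed simp
  then show "block_map m n f x i = block_map m n f y j"
    by (simp add: block_map_def)
qed

section \<open>The odometer coordinate under shifts, substitution and block maps\<close>

context aperiodic_substitution
begin

abbreviation \<pi> :: "(int \<Rightarrow> 'a) \<Rightarrow> nat \<Rightarrow> int" where
  "\<pi> \<equiv> mef r \<theta>"

lemma mem_mef_image_iff:
  "x \<in> (shift ^^ i) ` (subst_two_sided r \<theta> ^^ n) ` X \<longleftrightarrow> (\<exists>y\<in>X. x = sh (int i) (sub n y))"
  by (auto simp: shift_pow sub_def)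

text \<open>Resolves the description in \<open>mef\<close>: \<open>desubstitute\<close> yields a
  phase at every level, \<open>recognizable\<close> makes it unique modulo \<open>r^n\<close>, and
  the phases are coherent because \<open>sub (Suc n) y\<close> is \<open>sub n (sub 1 y)\<close>.
  From here on \<pi> is computed by exhibiting any phase \<open>t\<close>.\<close>

lemma mef_mem_carrier: "x \<in> X \<Longrightarrow> \<pi> x \<in> carrier (radic r)"
  and mef_sh_sub: "y \<in> X \<Longrightarrow> \<pi> (sh t (sub n y)) n = t mod int r ^ n"
proof -
  have *: "\<pi> x \<in> carrier (radic r) \<and> (\<forall>n t. \<forall>y\<in>X. x = sh t (sub n y) \<longrightarrow> \<pi> x n = t mod int r ^ n)"
    if x: "x \<in> X" for x
  proof -
    obtain \<tau> where \<tau>: "\<And>n. \<exists>y\<in>X. x = sh (\<tau> n) (sub n y)"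
      using desubstitute[OF x] by metis
    define z where "z n = \<tau> n mod int r ^ n" for n
    have z: "z n = t mod int r ^ n" if "y \<in> X" "x = sh t (sub n y)" for n t y
    proof -
      obtain y' where y': "y' \<in> X" "x = sh (\<tau> n) (sub n y')"
        using \<tau> by blast
      then have "sh (\<tau> n - t) (sub n y') = sub n y"
        using that(2) sh_eq_iff by metis
      then have "int r ^ n dvd \<tau> n - t"
        using recognizable[OF y'(1) that(1)] by force
      then show ?thesis
        by (simp add: z_def mod_eq_dvd_iff)
    qed
    have "[\<tau> (Suc n) = \<tau> n] (mod int r ^ n)" for n
    proof -
      obtain y where y: "y \<in> X" "x = sh (\<tau> (Suc n)) (sub (Suc n) y)"
        using \<tau> by blast
      have "z n = \<tau> (Suc n) mod int r ^ n"
        using z[of "sub 1 y"] y sub_mem_X[of y 1] by simp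
      then show ?thesis
        by (simp add: z_def cong_def)
    qed
    then have zc: "z \<in> carrier (radic r)"
      unfolding z_def by (intro radic_mod_carrier) simp_all
    have "\<pi> x = z"
      unfolding mef_def mem_mef_image_iff
    proof (rule the_equality, intro conjI allI impI)
      fix n i assume i: "i < r ^ n"
      show "z n = int i \<longleftrightarrow> (\<exists>y\<in>X. x = sh (int i) (sub n y))"
      proof
        assume zi: "z n = int i"
        obtain y where y: "y \<in> X" "x = sh (\<tau> n) (sub n y)"
          using \<tau> by blast
        have "\<tau> n = int i + int r ^ n * (\<tau> n div int r ^ n)"
          using zi by (simp add: z_def flip: zi)
        then have "x = sh (int i) (sub n (sh (\<tau> n div int r ^ n) y))"
          using y(2) by (simp add: sub_sh)
        then show "\<exists>y\<in>X. x = sh (int i) (sub n y)"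
          using y(1) by (intro bexI[of _ "sh (\<tau> n div int r ^ n) y"]) auto
      next
        assume "\<exists>y\<in>X. x = sh (int i) (sub n y)"
        then have "z n = int i mod int r ^ n"
          using z by blast
        also have "\<dots> = int i"
          using i by (metis mod_less of_nat_power zmod_int)
        finally show "z n = int i" .
      qed
    next
      fix w assume w: "w \<in> carrier (radic r) \<and>
          (\<forall>n i. i < r ^ n \<longrightarrow> (w n = int i) = (\<exists>y\<in>X. x = sh (int i) (sub n y)))"
      show "w = z"
      proof
        fix n
        have wn: "0 \<le> w n" "w n < int r ^ n"
          using w by (simp_all add: radic_carrier_iff)
        then have "nat (w n) < r ^ n"
          by (simp add: nat_less_iff)
        then obtain y where "y \<in> X" "x = sh (w n) (sub n y)"
          using w wn(1) by (metis int_nat_eq)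
        then show "w n = z n"
          using z wn by simp
      qed
    qed (fact zc)
    then show ?thesis
      using z zc by blast
  qed
  then show "x \<in> X \<Longrightarrow> \<pi> x \<in> carrier (radic r)"
    by blast
  show "y \<in> X \<Longrightarrow> \<pi> (sh t (sub n y)) n = t mod int r ^ n"
    using * sub_mem_X sh_mem_X by blast
qed

lemma mef_range: "x \<in> X \<Longrightarrow> 0 \<le> \<pi> x n" "x \<in> X \<Longrightarrow> \<pi> x n < int r ^ n"
  "x \<in> X \<Longrightarrow> \<pi> x n mod int r ^ n = \<pi> x n"
  using mef_mem_carrier[of x] by (simp_all add: radic_carrier_iff)

lemma mef_decomp:
  assumes "x \<in> X"
  obtains y where "y \<in> X" "x = sh (\<pi> x n) (sub n y)"
proof -
  obtain t y where y: "y \<in> X" "x = sh t (sub n y)"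
    using desubstitute[OF assms] by blast
  have "\<pi> x n = t mod int r ^ n"
    using mef_sh_sub y by blast
  then have "t = \<pi> x n + int r ^ n * (t div int r ^ n)"
    by simp
  then have "x = sh (\<pi> x n) (sub n (sh (t div int r ^ n) y))"
    using y(2) by (simp add: sub_sh)
  then show ?thesis
    using that y(1) sh_mem_X by blast
qed

lemma mef_sh:
  assumes "x \<in> X"
  shows "[\<pi> (sh t x) n = t + \<pi> x n] (mod int r ^ n)"
proof -
  obtain y where y: "y \<in> X" "x = sh (\<pi> x n) (sub n y)"
    using mef_decomp[OF assms] by blast
  have "\<pi> (sh t x) n = \<pi> (sh (t + \<pi> x n) (sub n y)) n"
    by (subst y(2)) simp
  then show ?thesis
    using mef_sh_sub[OF y(1)] by (simp add: cong_def)
qed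

lemma mef_sub:
  assumes "x \<in> X"
  shows "[\<pi> (sub k x) n = int r ^ k * \<pi> x n] (mod int r ^ n)"
proof -
  obtain y where y: "y \<in> X" "x = sh (\<pi> x n) (sub n y)"
    using mef_decomp[OF assms] by blast
  have "\<pi> (sub k x) n = \<pi> (sh (int r ^ k * \<pi> x n) (sub n (sub k y))) n"
    by (subst y(2)) (simp add: sub_sh add.commute)
  then show ?thesis
    using mef_sh_sub[OF sub_mem_X[OF y(1)]] by (simp add: cong_def)
qed

text \<open>By minimality all points \<open>\<Phi> (sub n x)\<close> have the same phase at level
  \<open>n\<close>, so the odometer coordinate changes by a constant. Stated for self-maps of
  \<open>X\<close>, since it is applied before bijectivity is known.\<close>

lemma mef_translation:
  assumes \<Phi>: "sliding \<Phi>" and X: "\<And>x. x \<in> X \<Longrightarrow> \<Phi> x \<in> X"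
  shows "\<exists>z\<in>carrier (radic r). \<forall>x\<in>X. \<forall>n. [\<pi> (\<Phi> x) n = z n + \<pi> x n] (mod int r ^ n)"
proof -
  have ex: "\<exists>i. \<forall>x\<in>X. [\<pi> (\<Phi> x) n = i + \<pi> x n] (mod int r ^ n)" for n
  proof -
    obtain x0 where x0: "x0 \<in> X"
      using ex_X by blast
    obtain i y0 where y0: "y0 \<in> X" "\<Phi> (sub n x0) = sh i (sub n y0)"
      using desubstitute X sub_mem_X[OF x0] by blast
    have i: "\<exists>y\<in>X. \<Phi> (sub n x) = sh i (sub n y)" if x: "x \<in> X" for x
    proof -
      have "\<exists>y\<in>X. sh (- i) (\<Phi> (sub n x)) = sub n y"
      proof (rule transfer_decode[OF x0 y0(1) _ x])
        show "sh (- i) (\<Phi> (sub n x0)) = sub n y0"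
          by (simp add: y0(2))
        fix L
        obtain K where "\<And>L x y. near (L + K) x y \<Longrightarrow> near L (\<Phi> x) (\<Phi> y)"
          using sliding_near[OF \<Phi>] by blast
        then show "\<exists>K. \<forall>x y. near K x y \<longrightarrow> near L (sh (- i) (\<Phi> (sub n x))) (sh (- i) (\<Phi> (sub n y)))"
          using near_sh near_sub by blast
      next
        show "sh (- i) (\<Phi> (sub n (sh m x))) = sh (int r ^ n * m) (sh (- i) (\<Phi> (sub n x)))" for m x
          by (simp add: sub_sh sliding_sh[OF \<Phi>])
      qed
      then show ?thesis
        using sh_eq_iff[of 0 _ i] by (metis diff_0 sh_0)
    qed
    have "[\<pi> (\<Phi> x) n = i + \<pi> x n] (mod int r ^ n)" if x: "x \<in> X" for x
    proof -
      obtain y where y: "y \<in> X" "x = sh (\<pi> x n) (sub n y)"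
        using mef_decomp[OF x] by blast
      obtain y' where y': "y' \<in> X" "\<Phi> (sub n y) = sh i (sub n y')"
        using i[OF y(1)] by blast
      have "\<pi> (\<Phi> x) n = \<pi> (sh (\<pi> x n + i) (sub n y')) n"
        by (subst y(2)) (simp add: sliding_sh[OF \<Phi>] y'(2))
      then show ?thesis
        using mef_sh_sub[OF y'(1)] by (simp add: cong_def add.commute)
    qed
    then show ?thesis
      by blast
  qed
  obtain x0 where x0: "x0 \<in> X"
    using ex_X by blast
  define z where "z n = (\<pi> (\<Phi> x0) n - \<pi> x0 n) mod int r ^ n" for n
  have "z \<in> carrier (radic r)"
    unfolding z_def
  proof (rule radic_mod_carrier)
    fix n
    have "[\<pi> x (Suc n) = \<pi> x n] (mod int r ^ n)" if "x \<in> X" for x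
      using mef_mem_carrier[OF that] mef_range(3)[OF that] by (simp add: radic_carrier_iff cong_def)
    then show "[\<pi> (\<Phi> x0) (Suc n) - \<pi> x0 (Suc n) = \<pi> (\<Phi> x0) n - \<pi> x0 n] (mod int r ^ n)"
      using x0 X by (intro cong_diff) auto
  qed simp
  moreover have "[\<pi> (\<Phi> x) n = z n + \<pi> x n] (mod int r ^ n)" if x: "x \<in> X" for x n
  proof -
    obtain i where i: "\<And>x. x \<in> X \<Longrightarrow> [\<pi> (\<Phi> x) n = i + \<pi> x n] (mod int r ^ n)"
      using ex by blast
    have "[z n = (i + \<pi> x0 n) - \<pi> x0 n] (mod int r ^ n)"
      using cong_diff[OF i[OF x0] cong_refl[of "\<pi> x0 n"]] by (simp add: z_def cong_def)
    then have "[z n + \<pi> x n = i + \<pi> x n] (mod int r ^ n)"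
      by (intro cong_add) simp_all
    then show ?thesis
      using i[OF x] cong_sym cong_trans by blast
  qed
  ultimately show ?thesis
    by blast
qed

text \<open>Existence in the description of \<open>kappa\<close> is \<open>mef_translation\<close>;
  uniqueness follows by cancelling at one point \<open>x0\<close>.\<close>

lemma kappa_eq_iff:
  assumes \<Phi>: "sliding \<Phi>" and X: "\<And>x. x \<in> X \<Longrightarrow> \<Phi> x \<in> X" and z: "z \<in> carrier (radic r)"
  shows "kappa r \<theta> (restrict \<Phi> X) = z \<longleftrightarrow>
    (\<forall>x\<in>X. \<forall>n. [\<pi> (\<Phi> x) n = z n + \<pi> x n] (mod int r ^ n))"
proof -
  obtain w where w: "w \<in> carrier (radic r)" "\<forall>x\<in>X. \<forall>n. [\<pi> (\<Phi> x) n = w n + \<pi> x n] (mod int r ^ n)"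
    using mef_translation[OF \<Phi> X] by blast
  have eq: "\<pi> (restrict \<Phi> X x) = z \<oplus>\<^bsub>radic r\<^esub> \<pi> x \<longleftrightarrow>
      (\<forall>n. [\<pi> (\<Phi> x) n = z n + \<pi> x n] (mod int r ^ n))" if "x \<in> X" for x z
    using that mef_range(3)[OF X[OF that]] by (auto simp: radic_def fun_eq_iff cong_def)
  obtain x0 where x0: "x0 \<in> X"
    using ex_X by blast
  have uniq: "y = w" if "y \<in> carrier (radic r)" "\<forall>x\<in>X. \<forall>n. [\<pi> (\<Phi> x) n = y n + \<pi> x n] (mod int r ^ n)" for y
  proof (rule radic_eqI[OF that(1) w(1)])
    fix n
    have "[y n + \<pi> x0 n = w n + \<pi> x0 n] (mod int r ^ n)"
      using that(2) w(2) x0 by (meson cong_sym cong_trans)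
    then show "[y n = w n] (mod int r ^ n)"
      by (simp add: cong_add_rcancel)
  qed
  have "kappa r \<theta> (restrict \<Phi> X) = w"
    unfolding kappa_def
  proof (rule the_equality)
    show "w \<in> carrier (radic r) \<and> (\<forall>x\<in>X. \<pi> (restrict \<Phi> X x) = w \<oplus>\<^bsub>radic r\<^esub> \<pi> x)"
      using w eq by blast
  qed (use uniq eq in blast)
  then show ?thesis
    using uniq[OF z] w by auto
qed

end

text \<open>Finitely many distinct points are told apart by one sufficiently large window, and the
  labelling \<open>f\<close> for this window then injects them into \<open>C\<close>.\<close>

lemma card_le_by_windows:
  fixes S :: "(int \<Rightarrow> 'a) set"
  assumes C: "finite C"
    and f: "\<And>L. \<exists>f. f ` S \<subseteq> C \<and> (\<forall>x\<in>S. \<forall>y\<in>S. f x = f y \<longrightarrow> near L x y)"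
  shows "finite S \<and> card S \<le> card C"
proof -
  have le: "card T \<le> card C" if T: "finite T" "T \<subseteq> S" for T
  proof -
    have "\<forall>p. \<exists>L. fst p \<noteq> snd p \<longrightarrow> \<not> near L (fst p) (snd p)" for p :: "(int \<Rightarrow> 'a) \<times> (int \<Rightarrow> 'a)"
      using near_all_eq by metis
    then obtain g where g: "\<And>x y :: int \<Rightarrow> 'a. x \<noteq> y \<Longrightarrow> \<not> near (g (x, y)) x y"
      by (metis fst_conv snd_conv)
    define L where "L = (\<Sum>p\<in>T \<times> T. \<bar>g p\<bar>)"
    obtain f where f: "f ` S \<subseteq> C" "\<forall>x\<in>S. \<forall>y\<in>S. f x = f y \<longrightarrow> near L x y"
      using assms(2) by blast
    have "inj_on f T"
    proof (rule inj_onI, rule ccontr)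
      fix x y assume xy: "x \<in> T" "y \<in> T" "f x = f y" "x \<noteq> y"
      have "\<bar>g (x, y)\<bar> \<le> L"
        unfolding L_def using xy T(1) by (intro member_le_sum) auto
      moreover have "near L x y"
        using f(2) xy T(2) by blast
      ultimately have "near (g (x, y)) x y"
        by (auto intro: near_mono)
      then show False
        using g xy(4) by blast
    qed
    moreover have "f ` T \<subseteq> C"
      using f(1) T(2) by blast
    ultimately show ?thesis
      using card_inj_on_le C by blast
  qed
  have "finite S"
  proof (rule ccontr)
    assume "infinite S"
    then obtain T where "finite T" "card T = Suc (card C)" "T \<subseteq> S"
      using infinite_arbitrarily_large by metis
    then show False
      using le[of T] by simp
  qed
  then show ?thesis
    using le by blast
qed

section \<open>Compactness\<close>

context constant_length
begin

abbreviation T :: "(int \<Rightarrow> 'a) topology" where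
  "T \<equiv> subst_shift_topology r \<theta>"

lemma openin_near: "openin (product_topology (\<lambda>_. discrete_topology UNIV) UNIV) {y. near L x y}"
proof -
  have "{y. near L x y} = (\<Pi>\<^sub>E i\<in>UNIV. if \<bar>i\<bar> \<le> L then {x i} else UNIV)"
    by (auto simp: near_def PiE_def Pi_def split: if_splits)
  moreover have "finite {i. (if \<bar>i\<bar> \<le> L then {x i} else UNIV) \<noteq> UNIV}"
    by (rule finite_subset[of _ "{-L..L}"]) (auto split: if_splits)
  ultimately show ?thesis
    by (simp add: openin_PiE_gen)
qed

lemma topspace_T [simp]: "topspace T = X"
  by (simp add: subst_shift_topology_def)

lemma openin_TI:
  assumes "U \<subseteq> X" "\<And>x. x \<in> U \<Longrightarrow> \<exists>L. \<forall>y\<in>X. near L x y \<longrightarrow> y \<in> U"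
  shows "openin T U"
proof (subst openin_subopen, intro ballI)
  fix x assume x: "x \<in> U"
  then obtain L where L: "\<forall>y\<in>X. near L x y \<longrightarrow> y \<in> U"
    using assms(2) by blast
  have "openin T ({y. near L x y} \<inter> X)"
    unfolding subst_shift_topology_def by (intro openin_subtopology_Int openin_near)
  then show "\<exists>V. openin T V \<and> x \<in> V \<and> V \<subseteq> U"
    using L x assms(1) by (intro exI[of _ "{y. near L x y} \<inter> X"]) (auto simp: near_def)
qed

lemma closedin_TI:
  assumes "A \<subseteq> X" "\<And>x. x \<in> X \<Longrightarrow> x \<notin> A \<Longrightarrow> \<exists>L. \<forall>y\<in>A. \<not> near L x y"
  shows "closedin T A"
  unfolding closedin_def topspace_T
proof (intro conjI openin_TI)
  fix x assume "x \<in> X - A"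
  then obtain L where "\<forall>y\<in>A. \<not> near L x y"
    using assms(2) by blast
  then show "\<exists>L. \<forall>y\<in>X. near L x y \<longrightarrow> y \<in> X - A"
    by (intro exI[of _ L]) blast
qed (use assms(1) in auto)

lemma compact_T: "compact_space T"
proof -
  let ?P = "product_topology (\<lambda>_::int. discrete_topology (UNIV :: 'a set)) UNIV"
  have "compact_space ?P"
    by (simp add: compact_space_product_topology compact_space_discrete_topology)
  moreover have "closedin ?P X"
  proof -
    have "openin ?P (- X)"
    proof (subst openin_subopen, intro ballI)
      fix x assume "x \<in> - X"
      then obtain L where "\<forall>y\<in>X. \<not> near L x y"
        using X_closed by blast
      then show "\<exists>V. openin ?P V \<and> x \<in> V \<and> V \<subseteq> - X"
        using openin_near by (intro exI[of _ "{y. near L x y}"]) (auto simp: near_def)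
    qed
    then show ?thesis
      by (simp add: closedin_def Compl_eq_Diff_UNIV)
  qed
  ultimately show ?thesis
    unfolding subst_shift_topology_def
    by (intro compact_space_subtopology) (simp add: closedin_compact_space)
qed

lemma Hausdorff_T: "Hausdorff_space T"
  unfolding subst_shift_topology_def
  by (intro Hausdorff_space_subtopology) (simp add: Hausdorff_space_product_topology)

lemma continuous_map_sliding:
  assumes \<Phi>: "sliding \<Phi>" and X: "\<And>x. x \<in> X \<Longrightarrow> \<Phi> x \<in> X"
  shows "continuous_map T T (restrict \<Phi> X)"
proof -
  obtain K where K: "\<And>L x y. near (L + K) x y \<Longrightarrow> near L (\<Phi> x) (\<Phi> y)"
    using sliding_near[OF \<Phi>] by blast
  have "continuous_map T (discrete_topology UNIV) (\<lambda>x. restrict \<Phi> X x i)" for i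
    unfolding continuous_map_def
  proof (intro conjI allI impI)
    fix U
    show "openin T {x \<in> topspace T. restrict \<Phi> X x i \<in> U}"
    proof (rule openin_TI)
      fix x assume x: "x \<in> {x \<in> topspace T. restrict \<Phi> X x i \<in> U}"
      have "\<Phi> x i = \<Phi> y i" if "near (\<bar>i\<bar> + K) x y" for y
        using K[OF that] by (simp add: near_def)
      with x show "\<exists>L. \<forall>y\<in>X. near L x y \<longrightarrow> y \<in> {x \<in> topspace T. restrict \<Phi> X x i \<in> U}"
        by (intro exI[of _ "\<bar>i\<bar> + K"]) auto
    qed auto
  qed auto
  then have "continuous_map T (product_topology (\<lambda>_. discrete_topology UNIV) UNIV) (restrict \<Phi> X)"
    by (simp add: continuous_map_componentwise_UNIV)
  then have "continuous_map T (subtopology (product_topology (\<lambda>_. discrete_topology UNIV) UNIV) X) (restrict \<Phi> X)"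
    using X by (intro continuous_map_into_subtopology) auto
  then show ?thesis
    by (simp add: subst_shift_topology_def)
qed

lemma compact_nest:
  assumes "\<And>n. C n \<subseteq> X" "\<And>n. C n \<noteq> {}" "\<And>n. C (Suc n) \<subseteq> C n"
    and "\<And>n x. x \<in> X \<Longrightarrow> x \<notin> C n \<Longrightarrow> \<exists>L. \<forall>y\<in>C n. \<not> near L x y"
  shows "\<exists>x. \<forall>n::nat. x \<in> C n"
proof -
  have "(\<Inter>n. C n) \<noteq> {}"
    using assms by (intro compact_space_imp_nest[OF compact_T] closedin_TI decseq_SucI) auto
  then show ?thesis
    by blast
qed

end

context aperiodic_substitution
begin

text \<open>Minimality makes the image dense and compactness makes it closed: the sets of points
  whose image agrees with \<open>w\<close> up to radius \<open>n\<close> are nested, closed and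
  nonempty.\<close>

lemma sliding_surj:
  assumes \<Phi>: "sliding \<Phi>" and X: "\<And>x. x \<in> X \<Longrightarrow> \<Phi> x \<in> X"
  shows "\<Phi> ` X = X"
proof
  show "X \<subseteq> \<Phi> ` X"
  proof
    fix w assume w: "w \<in> X"
    obtain K where K: "\<And>L x y. near (L + K) x y \<Longrightarrow> near L (\<Phi> x) (\<Phi> y)"
      using sliding_near[OF \<Phi>] by blast
    have "\<exists>x. \<forall>n::nat. x \<in> {x \<in> X. near n w (\<Phi> x)}"
    proof (rule compact_nest)
      fix n :: nat
      obtain x0 where x0: "x0 \<in> X"
        using ex_X by blast
      obtain m where "near n w (sh m (\<Phi> x0))"
        using minimal[OF w X[OF x0]] by blast
      then show "{x \<in> X. near n w (\<Phi> x)} \<noteq> {}"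
        using x0 sliding_sh[OF \<Phi>, of m x0] sh_mem_X[OF x0] by (metis (mono_tags, lifting) empty_Collect_eq)
      fix x assume x: "x \<in> X" "x \<notin> {x \<in> X. near n w (\<Phi> x)}"
      have "\<not> near n w (\<Phi> y)" if "near (n + K) x y" for y
        using K[OF that] x near_trans near_sym by blast
      then show "\<exists>L. \<forall>y\<in>{x \<in> X. near n w (\<Phi> x)}. \<not> near L x y"
        by blast
    qed (auto intro: near_mono)
    then obtain x where x: "x \<in> X" "\<And>n::nat. near n w (\<Phi> x)"
      by blast
    have "near L w (\<Phi> x)" for L
      using near_mono[OF x(2)[of "nat L"]] by simp
    then show "w \<in> \<Phi> ` X"
      using near_all_eq x(1) by blast
  qed
qed (use X in blast)

section \<open>Fibres over the odometer\<close>

text \<open>Over \<open>z\<close> every point is \<open>sh (z n) (sub n y)\<close>, and a window of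
  radius less than \<open>r^n\<close> meets only its blocks \<open>-1\<close>, \<open>0\<close> and
  \<open>1\<close>. So three letters of \<open>y\<close> determine the window, whatever its
  size.\<close>

lemma finite_fibre: "finite {x \<in> X. \<pi> x = z}"
proof -
  have "finite {x \<in> X. \<pi> x = z} \<and> card {x \<in> X. \<pi> x = z} \<le> card (UNIV :: ('a \<times> 'a \<times> 'a) set)"
  proof (rule card_le_by_windows)
    fix L :: int
    define n where "n = nat L"
    define R where "R = int r ^ n"
    have LR: "L < R"
    proof -
      have "int n < R"
        using less_r_pow[of n] by (simp add: R_def flip: of_nat_power)
      then show ?thesis
        unfolding n_def by linarith
    qed
    have "\<exists>y. y \<in> X \<and> x = sh (z n) (sub n y)" if "x \<in> {x \<in> X. \<pi> x = z}" for x
      using that mef_decomp[of x n] by blast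
    then obtain g where g: "\<And>x. x \<in> {x \<in> X. \<pi> x = z} \<Longrightarrow> g x \<in> X \<and> x = sh (z n) (sub n (g x))"
      by metis
    have "near L x y" if x: "x \<in> X" "\<pi> x = z" and y: "y \<in> X" "\<pi> y = z"
      and eq: "g x (-1) = g y (-1)" "g x 0 = g y 0" "g x 1 = g y 1" for x y
      unfolding near_def
    proof (intro allI impI)
      fix i :: int assume i: "\<bar>i\<bar> \<le> L"
      have z: "0 \<le> z n" "z n < R"
        using mef_range(1,2)[OF x(1), of n] by (simp_all add: x(2) R_def)
      define q where "q = (i + z n) div R"
      have "R * q \<le> i + z n" "i + z n < R * q + R"
        using z pos_mod_bound[of R "i + z n"] pos_mod_sign[of R "i + z n"] mult_div_mod_eq[of R "i + z n"]
        unfolding q_def by linarith+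
      then have "R * (-2) < R * q" "R * q < R * 2"
        using z i LR by linarith+
      then have "-2 < q" "q < 2"
        using z by (metis le_less_trans mult_less_cancel_left_pos)+
      then have "q = -1 \<or> q = 0 \<or> q = 1"
        by auto
      then have "g x q = g y q"
        using eq by auto
      then have "sub n (g x) (i + z n) = sub n (g y) (i + z n)"
        by (intro sub_cong) (simp_all add: q_def R_def)
      then show "x i = y i"
        using g[of x] g[of y] x y by (metis (mono_tags, lifting) mem_Collect_eq sh_apply)
    qed
    then show "\<exists>f. f ` {x \<in> X. \<pi> x = z} \<subseteq> (UNIV :: ('a \<times> 'a \<times> 'a) set) \<and>
        (\<forall>x\<in>{x \<in> X. \<pi> x = z}. \<forall>y\<in>{x \<in> X. \<pi> x = z}. f x = f y \<longrightarrow> near L x y)"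
      by (intro exI[of _ "\<lambda>x. (g x (-1), g x 0, g x 1)"]) auto
  qed simp
  then show ?thesis
    by blast
qed

text \<open>\<open>J\<close> has the entries of \<open>is\<close> as base \<open>r\<close> digits.
  The head of the list is applied last, hence it is the lowest digit.\<close>

lemma column_word:
  assumes "set is \<subseteq> {..<r}"
  shows "\<exists>J<r ^ length is. foldr (\<lambda>i F. column \<theta> i \<circ> F) is id = (\<lambda>a. pw (length is) a J)"
  using assms
proof (induction "is")
  case Nil
  then show ?case
    by auto
next
  case (Cons i "is")
  then have "set is \<subseteq> {..<r}"
    by simp
  from Cons.IH[OF this] obtain J where J: "J < r ^ length is"
      "foldr (\<lambda>i F. column \<theta> i \<circ> F) is id = (\<lambda>a. pw (length is) a J)"
    by blast
  have i: "i < r"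
    using Cons.prems by simp
  have "J * r + i < r ^ length (i # is)"
    using mult_le_mono1[of "Suc J" "r ^ length is" r] J(1) i by (simp add: mult.commute)
  moreover have foldr: "foldr (\<lambda>i F. column \<theta> i \<circ> F) (i # is) id = (\<lambda>a. column \<theta> i (pw (length is) a J))"
  proof -
    have "foldr (\<lambda>i F. column \<theta> i \<circ> F) (i # is) id =
        column \<theta> i \<circ> foldr (\<lambda>i F. column \<theta> i \<circ> F) is id"
      by simp
    also have "\<dots> = column \<theta> i \<circ> (\<lambda>a. pw (length is) a J)"
      by (simp only: J(2))
    finally show ?thesis
      by (simp only: comp_def)
  qed
  ultimately show ?case
    unfolding foldr using i by (intro exI[of _ "J * r + i"]) (simp add: column_def)
qed

text \<open>A column realizing the minimum may lie at an end of the word. Applying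
  \<open>\<theta>^2\<close> beforehand and reading its index 1 moves it inside and cannot enlarge
  the range. The square is taken because for \<open>r = 2\<close> index 1 is the last one of
  \<theta> itself.\<close>

lemma small_column:
  obtains m J where "0 < J" "J + 1 < r ^ m" "card (range (\<lambda>a. pw m a J)) \<le> column_number r \<theta>"
proof -
  let ?S = "{card (range (foldr (\<lambda>i F. column \<theta> i \<circ> F) is id)) | is. is \<noteq> [] \<and> set is \<subseteq> {..<r}}"
  have "finite ?S"
    by (rule finite_subset[of _ "{..card (UNIV :: 'a set)}"]) (auto intro: card_mono)
  moreover have "card (range (foldr (\<lambda>i F. column \<theta> i \<circ> F) [0] id)) \<in> ?S"
    using r_ge_2 by (intro CollectI exI[of _ "[0]"]) auto
  ultimately have "column_number r \<theta> \<in> ?S"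
    unfolding column_number_def using Min_in by blast
  then obtain "is" where "is": "set is \<subseteq> {..<r}"
      "column_number r \<theta> = card (range (foldr (\<lambda>i F. column \<theta> i \<circ> F) is id))"
    by blast
  then obtain J where J: "J < r ^ length is" "column_number r \<theta> = card (range (\<lambda>a. pw (length is) a J))"
    using column_word by metis
  define s where "s = length is"
  have pw: "pw (2 + s) a (r ^ s + J) = pw s (pw 2 a 1) J" for a
    using J(1) unfolding pw_add s_def by (simp add: div_add_self1)
  show ?thesis
  proof (rule that)
    show "0 < r ^ s + J"
      by simp
    have "4 * r ^ s \<le> r ^ (2 + s)"
      using r_ge_2 mult_le_mono[OF r_ge_2 r_ge_2] by (simp add: power_add power2_eq_square)
    then show "r ^ s + J + 1 < r ^ (2 + s)"
      using J(1) r_pow_pos(1)[of s] unfolding s_def[symmetric] by linarith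
    show "card (range (\<lambda>a. pw (2 + s) a (r ^ s + J))) \<le> column_number r \<theta>"
      unfolding J(2) pw s_def[symmetric] by (rule card_mono) auto
  qed
qed

text \<open>The fibre lies over the r-adic integer whose base \<open>r^m\<close> digits are all
  \<open>J\<close>; compactness gives a point there. At the origin each of its points shows a block
  of level \<open>m * n\<close> grown from letter \<open>J\<close> of some
  \<open>\<theta>^m(a)\<close>, which takes at most \<open>c\<close> values, and as \<open>J\<close>
  is interior these blocks cover every window.\<close>

lemma small_fibre: "\<exists>x\<in>X. card {y \<in> X. \<pi> y = \<pi> x} \<le> column_number r \<theta>"
proof -
  obtain m J where J: "0 < J" "J + 1 < r ^ m" "card (range (\<lambda>a. pw m a J)) \<le> column_number r \<theta>"
    using small_column by blast
  define R where "R = int r ^ m"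
  have JR: "int J + 1 < R"
    using J(2) by (metis R_def of_nat_1 of_nat_add of_nat_less_iff of_nat_power)
  define w where "w n = (\<Sum>i<n. int J * R ^ i)" for n
  have w_Suc: "w (Suc n) = w n + R ^ n * int J" for n
    by (simp add: w_def)
  have R1: "1 \<le> R ^ n" for n
    using JR by simp
  \<comment> \<open>The block containing the origin reaches at least \<open>n\<close> letters to
    both sides.\<close>
  have w_ge: "int n \<le> w n" "w n + int n < R ^ n" for n
  proof (induction n)
    case (Suc n)
    have "1 * 1 \<le> R ^ n * int J"
      using R1[of n] J(1) by (intro mult_mono) linarith+
    then show "int (Suc n) \<le> w (Suc n)"
      using Suc by (simp add: w_Suc)
    have "R ^ n * (int J + 1) + 1 * 1 \<le> R ^ n * (int J + 1) + R ^ n * (R - (int J + 1))"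
      using JR R1[of n] by (intro add_left_mono mult_mono) linarith+
    also have "\<dots> = R ^ Suc n"
      by (simp add: algebra_simps)
    finally show "w (Suc n) + int (Suc n) < R ^ Suc n"
      using Suc by (simp add: w_Suc algebra_simps)
  qed (simp_all add: w_def)
  define C where "C n = (\<lambda>y. sh (w n) (sub (m * n) y)) ` X" for n
  have CX: "C n \<subseteq> X" for n
    by (auto simp: C_def sub_mem_X)
  have C_Suc: "\<exists>y\<in>X. x = sh (w n) (sub (m * n) (sh (int J) (sub m y)))" if "x \<in> C (Suc n)" for x n
  proof -
    from that obtain y where "y \<in> X" "x = sh (w n + R ^ n * int J) (sub (m * n + m) y)"
      by (auto simp: C_def w_Suc add.commute)
    then show ?thesis
      by (intro bexI[of _ y]) (simp_all add: sub_sh R_def power_mult)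
  qed
  have "\<exists>x. \<forall>n. x \<in> C n"
  proof (rule compact_nest[OF CX])
    show "C n \<noteq> {}" for n
      using ex_X by (auto simp: C_def)
    show "C (Suc n) \<subseteq> C n" for n
    proof
      fix x assume "x \<in> C (Suc n)"
      then obtain y where y: "y \<in> X" "x = sh (w n) (sub (m * n) (sh (int J) (sub m y)))"
        using C_Suc by blast
      then have "sh (int J) (sub m y) \<in> X"
        using sub_mem_X by simp
      with y(2) show "x \<in> C n"
        unfolding C_def by blast
    qed
    fix n x assume x: "x \<in> X" "x \<notin> C n"
    show "\<exists>L. \<forall>y\<in>C n. \<not> near L x y"
    proof (rule ccontr)
      assume "\<not> ?thesis"
      then have *: "\<exists>y\<in>X. near L x (sh (w n) (sub (m * n) y))" for L
        by (auto simp: C_def)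
      have "\<exists>y\<in>X. sh (- w n) x = sub (m * n) y"
      proof (rule decode)
        fix L
        obtain y where "y \<in> X" "near (L + \<bar>- w n\<bar>) x (sh (w n) (sub (m * n) y))"
          using * by blast
        then show "\<exists>y\<in>X. near L (sh (- w n) x) (sub (m * n) y)"
          using near_sh by fastforce
      qed
      then obtain y where "y \<in> X" "x = sh (w n) (sub (m * n) y)"
        by (metis add.right_inverse sh_0 sh_sh)
      then show False
        using x by (auto simp: C_def)
    qed
  qed
  then obtain x0 where x0: "\<And>n. x0 \<in> C n"
    by blast
  have mem_C: "x \<in> C n" if x: "x \<in> X" "\<pi> x = \<pi> x0" for x n
  proof -
    obtain y where y: "y \<in> X" "x0 = sh (w n) (sub (m * n) y)"
      using x0[of n] by (auto simp: C_def)
    have "\<pi> x (m * n) = w n mod int r ^ (m * n)"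
      unfolding x(2) y(2) by (rule mef_sh_sub) fact
    also have "\<dots> = w n"
      using w_ge[of n] by (simp add: power_mult R_def)
    finally show ?thesis
      using mef_decomp[OF x(1), of "m * n"] by (metis C_def image_eqI)
  qed
  have "finite {x \<in> X. \<pi> x = \<pi> x0} \<and> card {x \<in> X. \<pi> x = \<pi> x0} \<le> card (range (\<lambda>a. pw m a J))"
  proof (rule card_le_by_windows)
    fix L :: int
    define n where "n = nat L"
    have Rn: "int r ^ (m * n) = R ^ n"
      by (simp add: R_def power_mult)
    obtain g where g: "\<And>x. x \<in> {x \<in> X. \<pi> x = \<pi> x0} \<Longrightarrow>
        g x \<in> X \<and> x = sh (w n) (sub (m * n) (sh (int J) (sub m (g x))))"
      using C_Suc[OF mem_C, of _ n] by (metis (mono_tags, lifting) mem_Collect_eq)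
    have J0: "sub m y (int J) = pw m (y 0) J" for y
      using JR unfolding sub_apply R_def[symmetric] by simp
    have "near L x y" if x: "x \<in> {x \<in> X. \<pi> x = \<pi> x0}" and y: "y \<in> {x \<in> X. \<pi> x = \<pi> x0}"
      and eq: "pw m (g x 0) J = pw m (g y 0) J" for x y
      unfolding near_def
    proof (intro allI impI)
      fix i :: int assume i: "\<bar>i\<bar> \<le> L"
      then have "0 \<le> i + w n" "i + w n < R ^ n"
        using w_ge[of n] unfolding n_def by linarith+
      then have "sub (m * n) (sh (int J) (sub m (g x))) (i + w n) = sub (m * n) (sh (int J) (sub m (g y))) (i + w n)"
        using eq by (intro sub_cong) (simp_all add: Rn sh_def J0)
      then show "x i = y i"
        using g[OF x] g[OF y] by (metis sh_apply)
    qed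
    then show "\<exists>f. f ` {x \<in> X. \<pi> x = \<pi> x0} \<subseteq> range (\<lambda>a. pw m a J) \<and>
        (\<forall>x\<in>{x \<in> X. \<pi> x = \<pi> x0}. \<forall>y\<in>{x \<in> X. \<pi> x = \<pi> x0}. f x = f y \<longrightarrow> near L x y)"
      by (intro exI[of _ "\<lambda>x. pw m (g x 0) J"]) blast
  qed simp
  then show ?thesis
    using J(3) x0[of 0] CX by (intro bexI[of _ x0]) auto
qed

end

context aperiodic_substitution
begin

section \<open>Automorphisms and commutation with powers of the substitution\<close>

lemma funpow_mem_X: "(\<And>x. x \<in> X \<Longrightarrow> \<Phi> x \<in> X) \<Longrightarrow> x \<in> X \<Longrightarrow> (\<Phi> ^^ n) x \<in> X"
  by (induction n) auto

text \<open>Since \<open>e z + k = 0\<close>, the map \<open>\<sigma>\<^sup>k \<circ> \<Phi>\<^sup>e\<close> sends each (finite) fibre of \<open>\<pi>\<close> onto itself,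
  hence is injective.\<close>

lemma sliding_inj:
  assumes \<Phi>: "sliding \<Phi>" and X: "\<And>x. x \<in> X \<Longrightarrow> \<Phi> x \<in> X"
    and z: "\<And>x n. x \<in> X \<Longrightarrow> [\<pi> (\<Phi> x) n = z n + \<pi> x n] (mod int r ^ n)"
    and e: "e \<ge> 1" "\<And>n. [int e * z n + k = 0] (mod int r ^ n)"
  shows "inj_on \<Phi> X"
proof (rule inj_onI)
  fix x x' assume x: "x \<in> X" and x': "x' \<in> X" and eq: "\<Phi> x = \<Phi> x'"
  define \<Psi> where "\<Psi> x = sh k ((\<Phi> ^^ e) x)" for x
  have pow: "[\<pi> ((\<Phi> ^^ q) x) n = int q * z n + \<pi> x n] (mod int r ^ n)" if "x \<in> X" for q x n
  proof (induction q)
    case (Suc q)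
    have "[\<pi> ((\<Phi> ^^ Suc q) x) n = z n + \<pi> ((\<Phi> ^^ q) x) n] (mod int r ^ n)"
      using z[OF funpow_mem_X[OF X that]] by simp
    also have "[z n + \<pi> ((\<Phi> ^^ q) x) n = z n + (int q * z n + \<pi> x n)] (mod int r ^ n)"
      using Suc by (intro cong_add) simp_all
    finally show ?case
      by (simp add: algebra_simps)
  qed simp
  have \<Psi>X: "\<Psi> x \<in> X" if "x \<in> X" for x
    using funpow_mem_X[OF X that] by (simp add: \<Psi>_def)
  have \<pi>\<Psi>: "\<pi> (\<Psi> x) = \<pi> x" if x: "x \<in> X" for x
  proof (rule radic_eqI)
    fix n
    have "[\<pi> (\<Psi> x) n = k + \<pi> ((\<Phi> ^^ e) x) n] (mod int r ^ n)"
      unfolding \<Psi>_def by (intro mef_sh funpow_mem_X X x)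
    also have "[k + \<pi> ((\<Phi> ^^ e) x) n = k + (int e * z n + \<pi> x n)] (mod int r ^ n)"
      using pow[OF x] by (intro cong_add) simp_all
    also have "k + (int e * z n + \<pi> x n) = (int e * z n + k) + \<pi> x n"
      by simp
    also have "[\<dots> = 0 + \<pi> x n] (mod int r ^ n)"
      using e(2) by (intro cong_add) simp_all
    finally show "[\<pi> (\<Psi> x) n = \<pi> x n] (mod int r ^ n)"
      by simp
  qed (use mef_mem_carrier \<Psi>X x in auto)
  have "(\<Phi> ^^ q) ` X = X" for q
    using sliding_surj[OF \<Phi> X] by (induction q) (simp, metis funpow.simps(2) image_comp)
  then have surj: "\<exists>y\<in>X. w = \<Psi> y" if "w \<in> X" for w
    using sh_mem_X[OF that, of "- k"] unfolding \<Psi>_def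
    by (metis (no_types, lifting) add.right_inverse imageE sh_0 sh_sh)
  have "\<pi> x = \<pi> x'"
  proof (rule radic_eqI)
    fix n
    have "[z n + \<pi> x n = z n + \<pi> x' n] (mod int r ^ n)"
      using z[OF x, of n] z[OF x', of n] eq by (metis cong_sym cong_trans)
    then show "[\<pi> x n = \<pi> x' n] (mod int r ^ n)"
      by (simp add: cong_add_lcancel)
  qed (use mef_mem_carrier x x' in auto)
  moreover have "inj_on \<Psi> {y \<in> X. \<pi> y = \<pi> x}"
  proof (rule finite_surj_inj[OF finite_fibre])
    show "{y \<in> X. \<pi> y = \<pi> x} \<subseteq> \<Psi> ` {y \<in> X. \<pi> y = \<pi> x}"
    proof
      fix w assume w: "w \<in> {y \<in> X. \<pi> y = \<pi> x}"
      then obtain y where y: "y \<in> X" "w = \<Psi> y"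
        using surj by blast
      then have "\<pi> y = \<pi> x"
        using w \<pi>\<Psi>[OF y(1)] by simp
      then show "w \<in> \<Psi> ` {y \<in> X. \<pi> y = \<pi> x}"
        using y by blast
    qed
  qed
  moreover have "\<Psi> x = \<Psi> x'"
    using e(1) eq unfolding \<Psi>_def by (cases e) (simp_all add: funpow_Suc_right del: funpow.simps(2))
  ultimately show "x = x'"
    using x x' by (auto dest: inj_onD)
qed

lemma sliding_Aut:
  assumes \<Phi>: "sliding \<Phi>" and X: "\<And>x. x \<in> X \<Longrightarrow> \<Phi> x \<in> X" and inj: "inj_on \<Phi> X"
  shows "restrict \<Phi> X \<in> Aut r \<theta>"
  unfolding Aut_def
proof (intro CollectI conjI ballI)
  show "homeomorphic_map T T (restrict \<Phi> X)"
  proof (rule continuous_imp_homeomorphic_map)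
    show "continuous_map T T (restrict \<Phi> X)"
      by (rule continuous_map_sliding[OF \<Phi> X])
    show "restrict \<Phi> X ` topspace T = topspace T"
      using sliding_surj[OF \<Phi> X] by simp
    show "inj_on (restrict \<Phi> X) (topspace T)"
      using inj by simp
  qed (fact compact_T Hausdorff_T)+
  show "restrict \<Phi> X (shift x) = shift (restrict \<Phi> X x)" if "x \<in> X" for x
    using that by (simp add: shift_eq_sh sliding_sh[OF \<Phi>])
qed simp

lemma Aut_image:
  assumes "restrict \<Phi> X \<in> Aut r \<theta>"
  shows "\<Phi> ` X = X"
proof -
  have "homeomorphic_map T T (restrict \<Phi> X)"
    using assms by (simp add: Aut_def)
  then have "restrict \<Phi> X ` X = X"
    using homeomorphic_imp_surjective_map by fastforce
  then show ?thesis
    by simp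
qed

text \<open>A window short compared with \<open>r^(M * n)\<close> meets at most two neighbouring
  blocks of \<open>sub (M * n) (\<Phi> x')\<close>. Their two letters also stand side by side in
  some \<open>y\<close> of \<open>X\<close>, so the window of \<open>\<Phi> x\<close> occurs in
  \<open>sub (M * n) y\<close>.\<close>

lemma endomorphism_of_commutation:
  assumes \<Phi>: "sliding \<Phi>" and M: "1 \<le> M"
    and comm: "\<And>x. x \<in> X \<Longrightarrow> \<Phi> (sub M x) = sh N (sub M (\<Phi> x))"
    and words: "\<And>x i. x \<in> X \<Longrightarrow> \<exists>y\<in>X. \<exists>j. \<Phi> x i = y j \<and> \<Phi> x (i + 1) = y (j + 1)"
    and x: "x \<in> X"
  shows "\<Phi> x \<in> X"
proof (rule X_closed)
  fix L :: int
  have iter: "\<exists>N'. \<forall>x\<in>X. \<Phi> (sub (M * n) x) = sh N' (sub (M * n) (\<Phi> x))" for n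
  proof (induction n)
    case 0
    show ?case
      by (intro exI[of _ 0]) simp
  next
    case (Suc n)
    then obtain N' where N': "\<And>x. x \<in> X \<Longrightarrow> \<Phi> (sub (M * n) x) = sh N' (sub (M * n) (\<Phi> x))"
      by blast
    have "\<Phi> (sub (M * Suc n) x) = sh (N + int r ^ M * N') (sub (M * Suc n) (\<Phi> x))" if "x \<in> X" for x
      using comm[OF sub_mem_X[OF that, of "M * n"]] N'[OF that] by (simp add: sub_sh)
    then show ?case
      by blast
  qed
  define n where "n = nat (2 * \<bar>L\<bar> + 1)"
  obtain N' where N': "\<And>x. x \<in> X \<Longrightarrow> \<Phi> (sub (M * n) x) = sh N' (sub (M * n) (\<Phi> x))"
    using iter by blast
  define R where "R = int r ^ (M * n)"
  have "n \<le> M * n"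
    using M by simp
  then have "n < r ^ (M * n)"
    using less_r_pow[of "M * n"] by linarith
  then have "int n < R"
    by (simp add: R_def flip: of_nat_power)
  then have R: "2 * \<bar>L\<bar> + 1 < R"
    unfolding n_def by linarith
  obtain t x' where x': "x' \<in> X" "x = sh t (sub (M * n) x')"
    using desubstitute[OF x] by blast
  define s where "s = t + N'"
  have \<Phi>x: "\<Phi> x = sh s (sub (M * n) (\<Phi> x'))"
    using x' N' by (simp add: sliding_sh[OF \<Phi>] s_def)
  \<comment> \<open>The index of the block that contains the left end of the window; shifting by
    \<open>R * (j - b)\<close> aligns it with block \<open>j\<close> of \<open>y\<close>.\<close>
  define b where "b = (s - \<bar>L\<bar>) div R"
  obtain y j where y: "y \<in> X" "\<Phi> x' b = y j" "\<Phi> x' (b + 1) = y (j + 1)"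
    using words[OF x'(1)] by blast
  have "near L (\<Phi> x) (sh (s + R * (j - b)) (sub (M * n) y))"
    unfolding near_def
  proof (intro allI impI)
    fix i :: int assume i: "\<bar>i\<bar> \<le> L"
    have b: "R * b \<le> s - \<bar>L\<bar>" "s - \<bar>L\<bar> < R * b + R"
      using R pos_mod_bound[of R "s - \<bar>L\<bar>"] pos_mod_sign[of R "s - \<bar>L\<bar>"] mult_div_mod_eq[of R "s - \<bar>L\<bar>"]
      unfolding b_def by linarith+
    have "(i + s) div R = b \<or> (i + s) div R = b + 1"
    proof (cases "i + s < R * b + R")
      case True
      then have "(i + s) div R = b"
        using b i R by (intro int_div_pos_eq[of _ _ _ "i + s - R * b"]) auto
      then show ?thesis ..
    next
      case False
      then have "(i + s) div R = b + 1"
        using b i R by (intro int_div_pos_eq[of _ _ _ "i + s - R * (b + 1)"]) (auto simp: algebra_simps)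
      then show ?thesis ..
    qed
    then have *: "\<Phi> x' ((i + s) div R) = y ((i + s) div R + (j - b))"
      using y by (auto simp: add.commute)
    have d: "(i + (s + R * (j - b))) div R = (i + s) div R + (j - b)"
      and m: "(i + (s + R * (j - b))) mod R = (i + s) mod R"
      using R by (simp_all flip: add.assoc)
    have "sub (M * n) (\<Phi> x') (i + s) = sub (M * n) y (i + (s + R * (j - b)))"
      by (rule sub_cong) (simp_all only: d m * R_def[symmetric])
    then show "\<Phi> x i = sh (s + R * (j - b)) (sub (M * n) y) i"
      by (simp add: \<Phi>x sh_def)
  qed
  then show "\<exists>y\<in>X. near L (\<Phi> x) y"
    using y(1) sub_mem_X by (meson sh_mem_X)
qed

text \<open>Applying \<pi> to both sides at one point gives
  \<open>z + r^M * \<pi> x = N + r^M * (z + \<pi> x)\<close>, where the point cancels.\<close>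

lemma translation_of_commutation:
  assumes X: "\<And>x. x \<in> X \<Longrightarrow> \<Phi> x \<in> X"
    and z: "\<And>x n. x \<in> X \<Longrightarrow> [\<pi> (\<Phi> x) n = z n + \<pi> x n] (mod int r ^ n)"
    and comm: "\<And>x. x \<in> X \<Longrightarrow> \<Phi> (sub M x) = sh N (sub M (\<Phi> x))"
  shows "[z n * (1 - int r ^ M) = N] (mod int r ^ n)"
proof -
  obtain x where x: "x \<in> X"
    using ex_X by blast
  have "[z n + int r ^ M * \<pi> x n = z n + \<pi> (sub M x) n] (mod int r ^ n)"
    using mef_sub[OF x] by (intro cong_add) (auto intro: cong_sym)
  also have "[z n + \<pi> (sub M x) n = \<pi> (\<Phi> (sub M x)) n] (mod int r ^ n)"
    using z[OF sub_mem_X[OF x]] by (rule cong_sym)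
  also have "\<pi> (\<Phi> (sub M x)) n = \<pi> (sh N (sub M (\<Phi> x))) n"
    by (simp add: comm[OF x])
  also have "[\<dots> = N + \<pi> (sub M (\<Phi> x)) n] (mod int r ^ n)"
    by (intro mef_sh sub_mem_X X x)
  also have "[N + \<pi> (sub M (\<Phi> x)) n = N + int r ^ M * \<pi> (\<Phi> x) n] (mod int r ^ n)"
    by (intro cong_add mef_sub X x) simp
  also have "[N + int r ^ M * \<pi> (\<Phi> x) n = N + int r ^ M * (z n + \<pi> x n)] (mod int r ^ n)"
    by (intro cong_add cong_mult z x) simp_all
  finally have "[z n + int r ^ M * \<pi> x n - int r ^ M * (z n + \<pi> x n) =
      N + int r ^ M * (z n + \<pi> x n) - int r ^ M * (z n + \<pi> x n)] (mod int r ^ n)"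
    by (intro cong_diff) simp_all
  then show ?thesis
    by (simp add: algebra_simps)
qed

text \<open>The points \<open>W a\<close> in the proof are the images of \<open>x0\<close> under the iterates of
  \<open>\<Phi> \<mapsto> \<sigma>\<^sup>N \<theta>\<^sup>p \<Phi> \<theta>\<^bsup>-p\<^esup>\<close>. They all lie in one fibre of \<open>\<pi>\<close>, chosen to have at most \<open>c\<close> points.\<close>

lemma commutation_of_translation:
  assumes \<Phi>: "sliding \<Phi>" and X: "\<And>x. x \<in> X \<Longrightarrow> \<Phi> x \<in> X"
    and z: "\<And>x n. x \<in> X \<Longrightarrow> [\<pi> (\<Phi> x) n = z n + \<pi> x n] (mod int r ^ n)"
    and N: "\<And>n. [z n * (1 - int r ^ p) = N] (mod int r ^ n)"
    and x: "x \<in> X"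
  defines "c \<equiv> column_number r \<theta>"
  shows "\<Phi> (sub (p * fact c) x) = sh (N * (\<Sum>i<fact c. int r ^ (p * i))) (sub (p * fact c) (\<Phi> x))"
proof -
  \<comment> \<open>The shift accumulated in \<open>a\<close> iterations. From
    \<open>z = N + r^p * z\<close> follows \<open>z = K a + r^(p * a) * z\<close>, so all iterates
    translate by the same \<open>z\<close>.\<close>
  define K where "K a = N * (\<Sum>i<a. int r ^ (p * i))" for a
  have K_add: "K (a + b) = K a + int r ^ (p * a) * K b" for a b
    by (induction b) (simp_all add: K_def algebra_simps power_add)
  have zK: "[K a + int r ^ (p * a) * z n = z n] (mod int r ^ n)" for a n
  proof (induction a)
    case 0
    show ?case
      by (simp add: K_def)
  next
    case (Suc a)
    have "[N + int r ^ p * z n = z n * (1 - int r ^ p) + int r ^ p * z n] (mod int r ^ n)"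
      using N by (intro cong_add) (auto intro: cong_sym)
    then have "[N + int r ^ p * z n = z n] (mod int r ^ n)"
      by (simp add: algebra_simps)
    then have "[K a + int r ^ (p * a) * (N + int r ^ p * z n) = K a + int r ^ (p * a) * z n] (mod int r ^ n)"
      by (rule cong_add[OF cong_refl cong_mult[OF cong_refl]])
    also note Suc
    finally show ?case
      by (simp add: K_def algebra_simps power_add)
  qed
  obtain w where w: "w \<in> X" "card {y \<in> X. \<pi> y = \<pi> w} \<le> c"
    using small_fibre unfolding c_def by blast
  obtain x0 where x0: "x0 \<in> X" "w = \<Phi> x0"
    using sliding_surj[OF \<Phi> X] w(1) by blast
  have "\<exists>y. y \<in> X \<and> x0 = sh (\<pi> x0 (p * a)) (sub (p * a) y)" for a
    using mef_decomp[OF x0(1), of "p * a"] by blast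
  then obtain y where y: "\<And>a. y a \<in> X" "\<And>a. x0 = sh (\<pi> x0 (p * a)) (sub (p * a) (y a))"
    by metis
  define I where "I a = \<pi> x0 (p * a)" for a
  have yI: "x0 = sh (I a) (sub (p * a) (y a))" for a
    using y(2) by (simp add: I_def)
  define W where "W a = sh (I a + K a) (sub (p * a) (\<Phi> (y a)))" for a
  have W_fibre: "W a \<in> {y \<in> X. \<pi> y = \<pi> w}" for a
  proof -
    have WX: "W a \<in> X"
      unfolding W_def using X y(1) sub_mem_X by simp
    have "\<pi> (W a) = \<pi> w"
    proof (rule radic_eqI)
      fix n
      have 1: "[\<pi> x0 n = I a + int r ^ (p * a) * \<pi> (y a) n] (mod int r ^ n)"
      proof -
        have "[\<pi> x0 n = I a + \<pi> (sub (p * a) (y a)) n] (mod int r ^ n)"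
          by (subst yI[of a]) (intro mef_sh sub_mem_X y)
        also have "[I a + \<pi> (sub (p * a) (y a)) n = I a + int r ^ (p * a) * \<pi> (y a) n] (mod int r ^ n)"
          by (intro cong_add mef_sub y) simp
        finally show ?thesis .
      qed
      have "[\<pi> (W a) n = (I a + K a) + \<pi> (sub (p * a) (\<Phi> (y a))) n] (mod int r ^ n)"
        unfolding W_def by (intro mef_sh sub_mem_X X y)
      also have "[(I a + K a) + \<pi> (sub (p * a) (\<Phi> (y a))) n =
          (I a + K a) + int r ^ (p * a) * \<pi> (\<Phi> (y a)) n] (mod int r ^ n)"
        by (intro cong_add mef_sub X y) simp_all
      also have "[(I a + K a) + int r ^ (p * a) * \<pi> (\<Phi> (y a)) n =
          (I a + K a) + int r ^ (p * a) * (z n + \<pi> (y a) n)] (mod int r ^ n)"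
        by (intro cong_add cong_mult z y) simp_all
      also have "(I a + K a) + int r ^ (p * a) * (z n + \<pi> (y a) n) =
          (K a + int r ^ (p * a) * z n) + (I a + int r ^ (p * a) * \<pi> (y a) n)"
        by (simp add: algebra_simps)
      also have "[\<dots> = z n + \<pi> x0 n] (mod int r ^ n)"
        using 1 by (intro cong_add zK) (auto intro: cong_sym)
      also have "[z n + \<pi> x0 n = \<pi> w n] (mod int r ^ n)"
        unfolding x0(2) using z[OF x0(1)] by (rule cong_sym)
      finally show "[\<pi> (W a) n = \<pi> w n] (mod int r ^ n)" .
    qed (use WX w mef_mem_carrier in auto)
    with WX show ?thesis
      by simp
  qed
  \<comment> \<open>The \<open>c + 1\<close> points \<open>W 0\<close>, ..., \<open>W c\<close> lie
    in a set of at most \<open>c\<close> elements.\<close>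
  have "\<not> inj_on W {..c}"
  proof
    assume "inj_on W {..c}"
    then have "card {..c} \<le> card {y \<in> X. \<pi> y = \<pi> w}"
      using W_fibre by (intro card_inj_on_le[of W] finite_fibre) auto
    then show False
      using w(2) by simp
  qed
  then obtain a b where ab: "a < b" "b \<le> c" "W a = W b"
    unfolding inj_on_def by (metis atMost_iff linorder_neqE_nat)
  define d where "d = b - a"
  have d: "b = a + d" "0 < d" "d \<le> c"
    using ab by (simp_all add: d_def)
  \<comment> \<open>Recognizability turns the two desubstitutions of \<open>x0\<close> into a
    relation between \<open>y a\<close> and \<open>y b\<close>, after which
    \<open>sub (p * a)\<close> cancels from \<open>W a = W b\<close>.\<close>
  have "sh (I b - I a) (sub (p * a) (sub (p * d) (y b))) = sub (p * a) (y a)"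
    using yI[of a] yI[of b] unfolding d(1) by (simp add: distrib_left sh_eq_iff[symmetric] del: sh_sh)
  then obtain q where q: "I b - I a = int r ^ (p * a) * q" "sh q (sub (p * d) (y b)) = y a"
    using recognizable[of "sub (p * d) (y b)" "y a"] y(1) sub_mem_X by blast
  have Ib: "I b = I a + int r ^ (p * a) * q"
    using q(1) by simp
  have "W a = sh (I b + K a) (sub (p * a) (\<Phi> (sub (p * d) (y b))))"
    unfolding W_def q(2)[symmetric] Ib by (simp add: sliding_sh[OF \<Phi>] sub_sh algebra_simps)
  moreover have "W b = sh (I b + K a) (sub (p * a) (sh (K d) (sub (p * d) (\<Phi> (y b)))))"
    unfolding W_def by (simp add: sub_sh d(1) K_add distrib_left add.assoc)
  ultimately have point: "\<Phi> (sub (p * d) (y b)) = sh (K d) (sub (p * d) (\<Phi> (y b)))"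
    using ab(3) by (simp add: sh_eq_iff sub_inject)
  \<comment> \<open>Both sides are local and agree on the orbit of \<open>y b\<close>, which is
    dense.\<close>
  have all: "\<Phi> (sub (p * d) x) = sh (K d) (sub (p * d) (\<Phi> x))" if x: "x \<in> X" for x
  proof (rule near_all_eq)
    fix L
    obtain H where H: "\<And>L x y. near (L + H) x y \<Longrightarrow> near L (\<Phi> x) (\<Phi> y)"
      using sliding_near[OF \<Phi>] by blast
    obtain m where m: "near (\<bar>L\<bar> + \<bar>K d\<bar> + H) x (sh m (y b))"
      using minimal[OF x y(1)] by blast
    have "near (\<bar>L\<bar> + \<bar>K d\<bar>) (\<Phi> (sub (p * d) x)) (\<Phi> (sub (p * d) (sh m (y b))))"
      using m by (intro H near_sub)
    then have "near L (\<Phi> (sub (p * d) x)) (\<Phi> (sub (p * d) (sh m (y b))))"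
      by (rule near_mono) simp
    moreover have "\<Phi> (sub (p * d) (sh m (y b))) = sh (K d) (sub (p * d) (\<Phi> (sh m (y b))))"
      by (simp add: sub_sh sliding_sh[OF \<Phi>] point add.commute)
    moreover have "near L (sh (K d) (sub (p * d) (\<Phi> x))) (sh (K d) (sub (p * d) (\<Phi> (sh m (y b)))))"
    proof (intro near_sh near_sub)
      have "near (\<bar>L\<bar> + \<bar>K d\<bar>) (\<Phi> x) (\<Phi> (sh m (y b)))"
        using m by (rule H)
      then show "near (L + \<bar>K d\<bar>) (\<Phi> x) (\<Phi> (sh m (y b)))"
        by (rule near_mono) simp
    qed
    ultimately show "near L (\<Phi> (sub (p * d) x)) (sh (K d) (sub (p * d) (\<Phi> x)))"
      using near_trans near_sym by metis
  qed
  have iter: "\<Phi> (sub (p * (d * s)) x) = sh (K (d * s)) (sub (p * (d * s)) (\<Phi> x))" if x: "x \<in> X" for s x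
  proof (induction s)
    case 0
    show ?case
      by (simp add: K_def)
  next
    case (Suc s)
    have "\<Phi> (sub (p * (d * Suc s)) x) = \<Phi> (sub (p * d) (sub (p * (d * s)) x))"
      by (simp add: distrib_left)
    also have "\<dots> = sh (K d) (sub (p * d) (\<Phi> (sub (p * (d * s)) x)))"
      by (intro all sub_mem_X x)
    also have "\<dots> = sh (K (d * Suc s)) (sub (p * (d * Suc s)) (\<Phi> x))"
      by (simp add: Suc sub_sh K_add distrib_left)
    finally show ?case .
  qed
  have "d dvd fact c"
    using d by (intro dvd_fact) auto
  then obtain s where "fact c = d * s"
    by (metis dvdE)
  with iter[OF x, of s] show ?thesis
    by (simp add: K_def)
qed

end

section \<open>From local rules and dotted words to commutation relations\<close>

lemma block_map_1_0: "block_map 1 0 f x i = f [x (i - 1), x i]"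
  by (simp add: block_map_def upto_rec1)

lemma block_map_1_1: "block_map 1 1 g x i = g [x (i - 1), x i, x (i + 1)]"
  by (simp add: block_map_def upto_rec1)

text \<open>With \<open>r \<le> 1\<close> the iterated images of a letter keep length at most 1, so
  primitivity leaves a single letter and at most one sequence.\<close>

lemma length_ge_2_of_primitive:
  fixes \<theta> :: "'a substitution"
  assumes len: "has_length r \<theta>" and prim: "primitive \<theta>" and inf: "infinite (subst_shift r \<theta>)"
  shows "2 \<le> r"
proof (rule ccontr)
  assume r: "\<not> 2 \<le> r"
  have le: "length (subst_word \<theta> w) \<le> length w" for w
    using len r by (induction w) (auto simp: subst_word_def has_length_def add_mono)
  have le_pow: "length ((subst_word \<theta> ^^ n) w) \<le> length w" for n w
    by (induction n) (use le order_trans in auto)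
  obtain k where k: "\<And>a b. b \<in> set ((subst_word \<theta> ^^ k) [a])"
    using prim by (auto simp: primitive_def)
  have eq: "b = b'" for b b' :: 'a
  proof -
    have "length ((subst_word \<theta> ^^ k) [b]) \<le> 1"
      using le_pow[of k "[b]"] by simp
    then obtain w where "(subst_word \<theta> ^^ k) [b] = [] \<or> (subst_word \<theta> ^^ k) [b] = [w]"
      by (cases "(subst_word \<theta> ^^ k) [b]") auto
    then show ?thesis
      using k[of b b] k[of b' b] by auto
  qed
  have "subst_shift r \<theta> \<subseteq> {undefined}"
    using eq by (auto intro!: ext)
  then show False
    using inf finite_subset by blast
qed

context constant_length
begin

lemma word_sub:
  assumes "\<And>k. k < length w \<Longrightarrow> w ! k = x (int k)" "j < r ^ n * length w"
  shows "(subst_word \<theta> ^^ n) w ! j = sub n x (int j)"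
proof -
  have "j div r ^ n < length w"
    using assms(2) by (simp add: div_less_iff_less_mult mult.commute)
  then show ?thesis
    using assms by (simp add: subst_word_nth sub_apply nat_mod_distrib nat_power_eq flip: zdiv_int zmod_int of_nat_power)
qed

lemma dotted_sub:
  assumes w: "\<And>k. k < length w \<Longrightarrow> w ! k = x (int k)"
    and j: "- (int r ^ n) \<le> j" "j < int r ^ n * int (length w)"
  shows "subst_dotted_nth \<theta> n [x (- 1)] w j = sub n x j"
proof (cases "j < 0")
  case True
  define i where "i = nat (int r ^ n + j)"
  have i: "int i = int r ^ n + j"
    using j(1) by (simp add: i_def)
  then have "int i < int (r ^ n)"
    using True by simp
  then have "i < r ^ n"
    by (simp only: of_nat_less_iff)
  \<comment> \<open>After the shift by \<open>-1\<close> the letter before the dot stands at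
    coordinate 0, where \<open>word_sub\<close> applies.\<close>
  then have "(subst_word \<theta> ^^ n) [x (- 1)] ! i = sub n (sh (- 1) x) (int i)"
    by (intro word_sub) (simp_all add: sh_def)
  also have "\<dots> = sub n x j"
    by (simp add: sub_sh sh_apply i)
  finally show ?thesis
    using True by (simp add: subst_dotted_nth_def dotted_nth_def subst_word_length i_def)
next
  case False
  then obtain i where i: "j = int i"
    by (metis linorder_not_less nonneg_int_cases)
  have "int i < int (r ^ n * length w)"
    using j(2) by (simp add: i)
  then have "i < r ^ n * length w"
    by (simp only: of_nat_less_iff)
  then have "(subst_word \<theta> ^^ n) w ! i = sub n x (int i)"
    by (intro word_sub w)
  then show ?thesis
    by (simp add: subst_dotted_nth_def dotted_nth_def i)
qed

text \<open>Shift invariance of \<open>X\<close> allows the place \<open>t\<close> of the occurrence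
  to be prescribed; \<open>-1\<close> serves the words that begin one letter before the dot.\<close>

lemma mem_language_iff:
  "w \<in> language r \<theta> \<longleftrightarrow> (\<exists>x\<in>X. \<forall>k<length w. w ! k = x (t + int k))"
proof
  assume "w \<in> language r \<theta>"
  then obtain x j where "x \<in> X" "\<forall>k<length w. w ! k = x (j + int k)"
    by (auto simp: language_def occurs_two_sided_def)
  then show "\<exists>x\<in>X. \<forall>k<length w. w ! k = x (t + int k)"
    by (intro bexI[of _ "sh (j - t) x"]) (auto simp: sh_apply algebra_simps)
qed (auto simp: language_def occurs_two_sided_def)

text \<open>Replacing \<open>x\<close> by \<open>sh m x\<close> shifts both sides by
  \<open>r^M * m\<close>, so it is enough to check one block for all points.\<close>

lemma commutation_iff_pointwise:
  assumes \<Phi>: "sliding \<Phi>"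
  shows "(\<forall>x\<in>X. \<Phi> (sub M x) = sh N (sub M (\<Phi> x))) \<longleftrightarrow>
    (\<forall>x\<in>X. \<forall>i<r ^ M. \<Phi> (sub M x) (int i) = sub M (\<Phi> x) (N + int i))"
proof (intro iffI ballI)
  fix x assume x: "x \<in> X" and *: "\<forall>x\<in>X. \<forall>i<r ^ M. \<Phi> (sub M x) (int i) = sub M (\<Phi> x) (N + int i)"
  show "\<Phi> (sub M x) = sh N (sub M (\<Phi> x))"
  proof
    fix j
    define m where "m = j div int r ^ M"
    define i where "i = nat (j mod int r ^ M)"
    have i: "int i = j mod int r ^ M" "j = int i + int r ^ M * m"
      by (simp_all add: i_def m_def)
    have "int i < int (r ^ M)"
      unfolding i(1) by simp
    then have "i < r ^ M"
      by (simp only: of_nat_less_iff)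
    then have "\<Phi> (sub M (sh m x)) (int i) = sub M (\<Phi> (sh m x)) (N + int i)"
      using * sh_mem_X[OF x] by blast
    then show "\<Phi> (sub M x) j = sh N (sub M (\<Phi> x)) j"
      by (subst (1 2) i(2)) (simp add: sub_sh sliding_sh[OF \<Phi>] sh_apply add_ac)
  qed
qed (auto simp: sh_def add.commute)

end

section \<open>The two equivalences\<close>

context aperiodic_substitution
begin

text \<open>Common form of both halves of the theorem: \<zeta> is \<open>k / (1 - r^p)\<close> in
  one, and 0 with \<open>p = 1\<close> and \<open>k = 0\<close> in the other. From right to left, a
  relation at level \<open>p * fact c\<close> has to recover \<zeta>, which is given by an equation
  at level \<open>p\<close>.\<close>

lemma automorphism_iff:
  assumes \<Phi>: "sliding \<Phi>" and p: "1 \<le> p" and \<zeta>: "\<zeta> \<in> carrier (radic r)"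
    and k: "\<And>n. [\<zeta> n * (1 - int r ^ p) = k] (mod int r ^ n)"
  defines "c \<equiv> column_number r \<theta>"
  defines "N \<equiv> k * (\<Sum>i<fact c. int r ^ (p * i))"
  shows "restrict \<Phi> X \<in> Aut r \<theta> \<and> kappa r \<theta> (restrict \<Phi> X) = \<zeta> \<longleftrightarrow>
    (\<forall>x\<in>X. \<exists>y\<in>X. \<Phi> x 0 = y 0 \<and> \<Phi> x 1 = y 1) \<and>
    (\<forall>x\<in>X. \<Phi> (sub (p * fact c) x) = sh N (sub (p * fact c) (\<Phi> x)))"
    (is "?L \<longleftrightarrow> ?words \<and> ?comm")
proof
  assume L: ?L
  then have X: "\<Phi> x \<in> X" if "x \<in> X" for x
    using Aut_image[of \<Phi>] that by blast
  have "\<And>x n. x \<in> X \<Longrightarrow> [\<pi> (\<Phi> x) n = \<zeta> n + \<pi> x n] (mod int r ^ n)"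
    using L kappa_eq_iff[OF \<Phi> X \<zeta>] by blast
  from commutation_of_translation[OF \<Phi> X this k] have ?comm
    by (simp add: c_def N_def)
  moreover have ?words
    using X by blast
  ultimately show "?words \<and> ?comm"
    by blast
next
  assume R: "?words \<and> ?comm"
  define M where "M = p * fact c"
  define S where "S = (\<Sum>i<fact c. int r ^ (p * i))"
  have comm: "\<Phi> (sub M x) = sh N (sub M (\<Phi> x))" if "x \<in> X" for x
    using R that by (simp add: M_def)
  have M: "1 \<le> M"
    using p by (simp add: M_def Suc_le_eq)
  have X: "\<Phi> x \<in> X" if x: "x \<in> X" for x
  proof (rule endomorphism_of_commutation[OF \<Phi> M comm _ x])
    fix x i assume "x \<in> X"
    then obtain y where "y \<in> X" "\<Phi> (sh i x) 0 = y 0" "\<Phi> (sh i x) 1 = y 1"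
      using R sh_mem_X by blast
    then show "\<exists>y\<in>X. \<exists>j. \<Phi> x i = y j \<and> \<Phi> x (i + 1) = y (j + 1)"
      by (intro bexI[of _ y] exI[of _ 0]) (simp_all add: sliding_sh[OF \<Phi>] sh_apply add.commute)
  qed
  obtain z where z: "z \<in> carrier (radic r)"
      "\<And>x n. x \<in> X \<Longrightarrow> [\<pi> (\<Phi> x) n = z n + \<pi> x n] (mod int r ^ n)"
    using mef_translation[OF \<Phi> X] by blast
  \<comment> \<open>The geometric sum turns the equation for \<zeta> into the one that
    \<open>z\<close> satisfies; there the factor \<open>1 - r^M\<close> can be cancelled.\<close>
  have S: "S * (1 - int r ^ p) = 1 - int r ^ M"
    using one_diff_power_eq[of "int r ^ p" "fact c"]
    unfolding S_def M_def power_mult by (metis mult.commute)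
  have coprime: "coprime (1 - int r ^ M) (int r ^ n)" for n
  proof -
    have "coprime (1 - int r ^ M) (int r ^ M)"
      by (metis coprime_1_left coprime_iff_gcd_eq_1 diff_add_cancel gcd_add1 gcd.commute)
    then show ?thesis
      using M by (simp add: coprime_power_right_iff)
  qed
  have "z = \<zeta>"
  proof (rule radic_eqI[OF z(1) \<zeta>])
    fix n
    have "[S * (\<zeta> n * (1 - int r ^ p)) = S * k] (mod int r ^ n)"
      by (intro cong_mult k cong_refl)
    then have "[\<zeta> n * (1 - int r ^ M) = N] (mod int r ^ n)"
      unfolding N_def S[symmetric] S_def[symmetric] by (simp only: mult_ac)
    moreover have "[z n * (1 - int r ^ M) = N] (mod int r ^ n)"
      by (rule translation_of_commutation[OF X z(2) comm])
    ultimately have "[z n * (1 - int r ^ M) = \<zeta> n * (1 - int r ^ M)] (mod int r ^ n)"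
      using cong_sym cong_trans by blast
    then show "[z n = \<zeta> n] (mod int r ^ n)"
      using coprime cong_mult_rcancel by blast
  qed
  note \<zeta>_trans = z(2)[unfolded this]
  have rp: "2 \<le> r ^ p"
    using r_ge_2 p by (metis le_trans power_increasing power_one_right one_le_numeral)
  have "inj_on \<Phi> X"
  proof (rule sliding_inj[OF \<Phi> X \<zeta>_trans])
    show "1 \<le> r ^ p - 1"
      using rp by simp
    fix n
    have "[\<zeta> n * (1 - int r ^ p) - k = k - k] (mod int r ^ n)"
      by (intro cong_diff k cong_refl)
    then have "[- (\<zeta> n * (1 - int r ^ p) - k) = - 0] (mod int r ^ n)"
      by (simp only: cong_minus_minus_iff) simp
    then show "[int (r ^ p - 1) * \<zeta> n + k = 0] (mod int r ^ n)"
      using rp by (simp add: of_nat_diff algebra_simps)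
  qed
  then have "restrict \<Phi> X \<in> Aut r \<theta>"
    using sliding_Aut[OF \<Phi> X] by blast
  moreover have "kappa r \<theta> (restrict \<Phi> X) = \<zeta>"
    using kappa_eq_iff[OF \<Phi> X \<zeta>] \<zeta>_trans by blast
  ultimately show ?L
    by blast
qed

lemma automorphism_1_0_iff:
  assumes p: "1 \<le> p" and k: "k < r ^ p - 1" and c: "c = column_number r \<theta>"
  shows "block_map_on r \<theta> 1 0 f \<in> Aut r \<theta> \<and>
      kappa r \<theta> (block_map_on r \<theta> 1 0 f) = radic_quotient r (int k) (1 - int r ^ p) \<longleftrightarrow>
    (\<forall>x0 x1 x2. [x0, x1, x2] \<in> language r \<theta> \<longrightarrow> [f [x0, x1], f [x1, x2]] \<in> language r \<theta>) \<and>
    (\<forall>y x0 x1. [y, x0, x1] \<in> language r \<theta> \<longrightarrow>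
      (\<forall>i<r ^ (fact c * p).
        f [subst_dotted_nth \<theta> (fact c * p) [y] [x0] (int i - 1),
           subst_dotted_nth \<theta> (fact c * p) [y] [x0] (int i)]
        = (subst_word \<theta> ^^ (fact c * p)) [f [y, x0], f [x0, x1]]
            ! (k * (\<Sum>j<fact c. r ^ (j * p)) + i)))"
    (is "?A \<longleftrightarrow> ?B \<and> ?C")
proof -
  define \<Phi> where "\<Phi> = block_map 1 0 f"
  have \<Phi>: "sliding \<Phi>"
    by (simp add: \<Phi>_def sliding_block_map)
  have \<Phi>_apply: "\<Phi> x i = f [x (i - 1), x i]" for x i
    unfolding \<Phi>_def by (rule block_map_1_0)
  define M where "M = fact c * p"
  define S where "S = (\<Sum>j<fact c. r ^ (j * p))"
  define N where "N = k * S"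
  have int_S: "int S = (\<Sum>i<fact c. int r ^ (p * i))"
    by (simp add: S_def mult.commute)
  \<comment> \<open>Keeps the index \<open>N + i\<close> inside the image of a two-letter word,
    which has length \<open>2 * r^M\<close>. The bound is \<open>k \<le> r^p - 1\<close> multiplied
    by the geometric sum.\<close>
  have N_le: "N < r ^ M"
  proof -
    have "int k + 1 \<le> int (r ^ p)"
      using k by linarith
    then have "int k \<le> int r ^ p - 1"
      unfolding of_nat_power by linarith
    then have "int k * int S \<le> (int r ^ p - 1) * int S"
      by (rule mult_right_mono) simp
    also have "\<dots> = int r ^ M - 1"
    proof -
      have "int S = (\<Sum>i<fact c. (int r ^ p) ^ i)" "int r ^ M = (int r ^ p) ^ fact c"
        by (simp_all add: int_S M_def power_mult mult.commute[of "fact c"])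
      then show ?thesis
        using one_diff_power_eq[of "int r ^ p" "fact c"] by (simp add: algebra_simps)
    qed
    finally have "int N < int (r ^ M)"
      by (simp add: N_def)
    then show ?thesis
      by (simp only: of_nat_less_iff)
  qed
  have "?A \<longleftrightarrow> (\<forall>x\<in>X. \<exists>y\<in>X. \<Phi> x 0 = y 0 \<and> \<Phi> x 1 = y 1) \<and>
      (\<forall>x\<in>X. \<Phi> (sub M x) = sh (int N) (sub M (\<Phi> x)))"
  proof -
    note q = radic_quotient_one_minus_power[OF r_pow_pos(2) p, where k = "int k"]
    have "[radic_quotient r (int k) (1 - int r ^ p) n * (1 - int r ^ p) = int k] (mod int r ^ n)" for n
      using q by blast
    from automorphism_iff[OF \<Phi> p q(1) this] show ?thesis
      by (simp add: block_map_on_def \<Phi>_def c M_def N_def int_S mult.commute)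
  qed
  moreover have "(\<forall>x\<in>X. \<exists>y\<in>X. \<Phi> x 0 = y 0 \<and> \<Phi> x 1 = y 1) \<longleftrightarrow> ?B"
  proof
    assume *: "\<forall>x\<in>X. \<exists>y\<in>X. \<Phi> x 0 = y 0 \<and> \<Phi> x 1 = y 1"
    show ?B
      unfolding mem_language_iff[of "[_, _, _]" "-1"] mem_language_iff[of "[_, _]" 0]
      using * by (fastforce simp: \<Phi>_apply All_less_Suc numeral_2_eq_2)
  next
    assume B: ?B
    show "\<forall>x\<in>X. \<exists>y\<in>X. \<Phi> x 0 = y 0 \<and> \<Phi> x 1 = y 1"
    proof
      fix x assume "x \<in> X"
      then have "[x (-1), x 0, x 1] \<in> language r \<theta>"
        unfolding mem_language_iff[of "[_, _, _]" "-1"] by (intro bexI[of _ x]) (simp_all add: All_less_Suc)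
      then have "[\<Phi> x 0, \<Phi> x 1] \<in> language r \<theta>"
        using B by (simp add: \<Phi>_apply)
      then show "\<exists>y\<in>X. \<Phi> x 0 = y 0 \<and> \<Phi> x 1 = y 1"
        unfolding mem_language_iff[of "[_, _]" 0] by (auto simp: All_less_Suc)
    qed
  qed
  moreover have "(\<forall>x\<in>X. \<Phi> (sub M x) = sh (int N) (sub M (\<Phi> x))) \<longleftrightarrow> ?C"
  proof -
    have eq: "f [subst_dotted_nth \<theta> M [x (-1)] [x 0] (int i - 1), subst_dotted_nth \<theta> M [x (-1)] [x 0] (int i)]
        = \<Phi> (sub M x) (int i)"
      "(subst_word \<theta> ^^ M) [f [x (-1), x 0], f [x 0, x 1]] ! (N + i) = sub M (\<Phi> x) (int N + int i)"
      if i: "i < r ^ M" for x i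
    proof -
      have R: "int i < int r ^ M" "1 \<le> int r ^ M"
        using i r_ge_2 by (simp_all flip: of_nat_power)
      have "subst_dotted_nth \<theta> M [x (-1)] [x 0] j = sub M x j" if "- (int r ^ M) \<le> j" "j < int r ^ M" for j
        using dotted_sub[of "[x 0]" x M j] that by simp
      from this[of "int i - 1"] this[of "int i"] R have "subst_dotted_nth \<theta> M [x (-1)] [x 0] (int i - 1) = sub M x (int i - 1)"
          "subst_dotted_nth \<theta> M [x (-1)] [x 0] (int i) = sub M x (int i)"
        by auto
      then show "f [subst_dotted_nth \<theta> M [x (-1)] [x 0] (int i - 1), subst_dotted_nth \<theta> M [x (-1)] [x 0] (int i)]
          = \<Phi> (sub M x) (int i)"
        unfolding \<Phi>_apply by (simp only:)
      show "(subst_word \<theta> ^^ M) [f [x (-1), x 0], f [x 0, x 1]] ! (N + i) = sub M (\<Phi> x) (int N + int i)"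
        unfolding of_nat_add[symmetric]
        by (rule word_sub) (use i N_le in \<open>auto simp: \<Phi>_apply less_Suc_eq\<close>)
    qed
    have "?C \<longleftrightarrow> (\<forall>x\<in>X. \<forall>i<r ^ M. \<Phi> (sub M x) (int i) = sub M (\<Phi> x) (int N + int i))"
    proof
      assume C: ?C
      show "\<forall>x\<in>X. \<forall>i<r ^ M. \<Phi> (sub M x) (int i) = sub M (\<Phi> x) (int N + int i)"
      proof (intro ballI allI impI)
        fix x i assume x: "x \<in> X" and i: "i < r ^ M"
        have "[x (-1), x 0, x 1] \<in> language r \<theta>"
          unfolding mem_language_iff[of "[_, _, _]" "-1"]
          using x by (intro bexI[of _ x]) (simp_all add: All_less_Suc)
        then show "\<Phi> (sub M x) (int i) = sub M (\<Phi> x) (int N + int i)"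
          using C i unfolding M_def[symmetric] S_def[symmetric] N_def[symmetric] by (metis eq)
      qed
    next
      assume *: "\<forall>x\<in>X. \<forall>i<r ^ M. \<Phi> (sub M x) (int i) = sub M (\<Phi> x) (int N + int i)"
      show ?C
        unfolding M_def[symmetric] S_def[symmetric] N_def[symmetric]
      proof (intro allI impI)
        fix y x0 x1 i assume w: "[y, x0, x1] \<in> language r \<theta>" and i: "i < r ^ M"
        then obtain x where x: "x \<in> X" "y = x (-1)" "x0 = x 0" "x1 = x 1"
          unfolding mem_language_iff[of "[_, _, _]" "-1"] by (auto simp: All_less_Suc)
        show "f [subst_dotted_nth \<theta> M [y] [x0] (int i - 1), subst_dotted_nth \<theta> M [y] [x0] (int i)]
            = (subst_word \<theta> ^^ M) [f [y, x0], f [x0, x1]] ! (N + i)"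
          using * x(1) i unfolding x(2-4) eq[OF i] by blast
      qed
    qed
    then show ?thesis
      unfolding commutation_iff_pointwise[OF \<Phi>] by blast
  qed
  ultimately show ?thesis
    by blast
qed

lemma automorphism_1_1_iff:
  assumes c: "c = column_number r \<theta>"
  shows "block_map_on r \<theta> 1 1 g \<in> Aut r \<theta> \<and>
      kappa r \<theta> (block_map_on r \<theta> 1 1 g) = \<zero>\<^bsub>radic r\<^esub> \<longleftrightarrow>
    (\<forall>x0 x1 x2 x3. [x0, x1, x2, x3] \<in> language r \<theta> \<longrightarrow>
      [g [x0, x1, x2], g [x1, x2, x3]] \<in> language r \<theta>) \<and>
    (\<forall>y x0 x1. [y, x0, x1] \<in> language r \<theta> \<longrightarrow>
      (\<forall>i<r ^ fact c.
        g [subst_dotted_nth \<theta> (fact c) [y] [x0, x1] (int i - 1),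
           subst_dotted_nth \<theta> (fact c) [y] [x0, x1] (int i),
           subst_dotted_nth \<theta> (fact c) [y] [x0, x1] (int i + 1)]
        = (subst_word \<theta> ^^ fact c) [g [y, x0, x1]] ! i))"
    (is "?A \<longleftrightarrow> ?B \<and> ?C")
proof -
  define \<Phi> where "\<Phi> = block_map 1 1 g"
  have \<Phi>: "sliding \<Phi>"
    by (simp add: \<Phi>_def sliding_block_map)
  have \<Phi>_apply: "\<Phi> x i = g [x (i - 1), x i, x (i + 1)]" for x i
    unfolding \<Phi>_def by (rule block_map_1_1)
  define M where "M = (fact c :: nat)"
  have "?A \<longleftrightarrow> (\<forall>x\<in>X. \<exists>y\<in>X. \<Phi> x 0 = y 0 \<and> \<Phi> x 1 = y 1) \<and>
      (\<forall>x\<in>X. \<Phi> (sub M x) = sh 0 (sub M (\<Phi> x)))"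
    using automorphism_iff[OF \<Phi>, of 1 "\<lambda>_. 0" 0]
    by (simp add: block_map_on_def \<Phi>_def c M_def radic_def)
  moreover have "(\<forall>x\<in>X. \<exists>y\<in>X. \<Phi> x 0 = y 0 \<and> \<Phi> x 1 = y 1) \<longleftrightarrow> ?B"
  proof
    assume *: "\<forall>x\<in>X. \<exists>y\<in>X. \<Phi> x 0 = y 0 \<and> \<Phi> x 1 = y 1"
    show ?B
    proof (intro allI impI)
      fix x0 x1 x2 x3 assume "[x0, x1, x2, x3] \<in> language r \<theta>"
      then obtain x where x: "x \<in> X" "x0 = x (-1)" "x1 = x 0" "x2 = x 1" "x3 = x 2"
        unfolding mem_language_iff[of "[_, _, _, _]" "-1"] by (auto simp: All_less_Suc)
      have "g [x0, x1, x2] = \<Phi> x 0" "g [x1, x2, x3] = \<Phi> x 1"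
        by (simp_all add: x(2-) \<Phi>_apply)
      moreover obtain y where "y \<in> X" "\<Phi> x 0 = y 0" "\<Phi> x 1 = y 1"
        using * x(1) by blast
      ultimately show "[g [x0, x1, x2], g [x1, x2, x3]] \<in> language r \<theta>"
        unfolding mem_language_iff[of "[_, _]" 0] by (intro bexI[of _ y]) (simp_all add: All_less_Suc)
    qed
  next
    assume B: ?B
    show "\<forall>x\<in>X. \<exists>y\<in>X. \<Phi> x 0 = y 0 \<and> \<Phi> x 1 = y 1"
    proof
      fix x assume "x \<in> X"
      then have "[x (-1), x 0, x 1, x 2] \<in> language r \<theta>"
        unfolding mem_language_iff[of "[_, _, _, _]" "-1"] by (intro bexI[of _ x]) (simp_all add: All_less_Suc)
      then have "[\<Phi> x 0, \<Phi> x 1] \<in> language r \<theta>"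
        using B by (simp add: \<Phi>_apply)
      then show "\<exists>y\<in>X. \<Phi> x 0 = y 0 \<and> \<Phi> x 1 = y 1"
        unfolding mem_language_iff[of "[_, _]" 0] by (auto simp: All_less_Suc)
    qed
  qed
  moreover have "(\<forall>x\<in>X. \<Phi> (sub M x) = sh 0 (sub M (\<Phi> x))) \<longleftrightarrow> ?C"
  proof -
    have eq: "g [subst_dotted_nth \<theta> M [x (-1)] [x 0, x 1] (int i - 1),
          subst_dotted_nth \<theta> M [x (-1)] [x 0, x 1] (int i),
          subst_dotted_nth \<theta> M [x (-1)] [x 0, x 1] (int i + 1)] = \<Phi> (sub M x) (int i)"
      "(subst_word \<theta> ^^ M) [g [x (-1), x 0, x 1]] ! i = sub M (\<Phi> x) (0 + int i)"
      if i: "i < r ^ M" for x i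
    proof -
      have R: "int i < int r ^ M" "1 \<le> int r ^ M"
        using i r_ge_2 by (simp_all flip: of_nat_power)
      \<comment> \<open>At \<open>i = r^M - 1\<close> the right neighbour is the first letter of the
        next block, hence the range up to \<open>2 * r^M\<close> and the letter \<open>x 1\<close>
        in the dotted word.\<close>
      have "subst_dotted_nth \<theta> M [x (-1)] [x 0, x 1] j = sub M x j"
        if "- (int r ^ M) \<le> j" "j < int r ^ M * 2" for j
        by (rule dotted_sub) (use that in \<open>auto simp: less_Suc_eq\<close>)
      from this[of "int i - 1"] this[of "int i"] this[of "int i + 1"] R have
          "subst_dotted_nth \<theta> M [x (-1)] [x 0, x 1] (int i - 1) = sub M x (int i - 1)"
          "subst_dotted_nth \<theta> M [x (-1)] [x 0, x 1] (int i) = sub M x (int i)"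
          "subst_dotted_nth \<theta> M [x (-1)] [x 0, x 1] (int i + 1) = sub M x (int i + 1)"
        by auto
      then show "g [subst_dotted_nth \<theta> M [x (-1)] [x 0, x 1] (int i - 1),
          subst_dotted_nth \<theta> M [x (-1)] [x 0, x 1] (int i),
          subst_dotted_nth \<theta> M [x (-1)] [x 0, x 1] (int i + 1)] = \<Phi> (sub M x) (int i)"
        unfolding \<Phi>_apply by (simp only:)
      show "(subst_word \<theta> ^^ M) [g [x (-1), x 0, x 1]] ! i = sub M (\<Phi> x) (0 + int i)"
        using word_sub[of "[g [x (-1), x 0, x 1]]" "\<Phi> x" i M] i by (simp add: \<Phi>_apply)
    qed
    have "?C \<longleftrightarrow> (\<forall>x\<in>X. \<forall>i<r ^ M. \<Phi> (sub M x) (int i) = sub M (\<Phi> x) (0 + int i))"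
    proof
      assume C: ?C
      show "\<forall>x\<in>X. \<forall>i<r ^ M. \<Phi> (sub M x) (int i) = sub M (\<Phi> x) (0 + int i)"
      proof (intro ballI allI impI)
        fix x i assume x: "x \<in> X" and i: "i < r ^ M"
        have "[x (-1), x 0, x 1] \<in> language r \<theta>"
          unfolding mem_language_iff[of "[_, _, _]" "-1"]
          using x by (intro bexI[of _ x]) (simp_all add: All_less_Suc)
        then show "\<Phi> (sub M x) (int i) = sub M (\<Phi> x) (0 + int i)"
          using C i unfolding M_def[symmetric] by (metis eq)
      qed
    next
      assume *: "\<forall>x\<in>X. \<forall>i<r ^ M. \<Phi> (sub M x) (int i) = sub M (\<Phi> x) (0 + int i)"
      show ?C
        unfolding M_def[symmetric]
      proof (intro allI impI)
        fix y x0 x1 i assume w: "[y, x0, x1] \<in> language r \<theta>" and i: "i < r ^ M"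
        then obtain x where x: "x \<in> X" "y = x (-1)" "x0 = x 0" "x1 = x 1"
          unfolding mem_language_iff[of "[_, _, _]" "-1"] by (auto simp: All_less_Suc)
        show "g [subst_dotted_nth \<theta> M [y] [x0, x1] (int i - 1),
            subst_dotted_nth \<theta> M [y] [x0, x1] (int i),
            subst_dotted_nth \<theta> M [y] [x0, x1] (int i + 1)]
            = (subst_word \<theta> ^^ M) [g [y, x0, x1]] ! i"
          using * x(1) i unfolding x(2-4) eq[OF i] by blast
      qed
    qed
    then show ?thesis
      unfolding commutation_iff_pointwise[OF \<Phi>] by blast
  qed
  ultimately show ?thesis
    by blast
qed

end

theorem proposition3p21:
  fixes \<theta> :: "'a::finite substitution" and r c :: nat
  assumes "has_length r \<theta>"
    and "inj \<theta>"
    and "primitive \<theta>"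
    and "height r \<theta> = 1"
    and "c = column_number r \<theta>"
    and "infinite (subst_shift r \<theta>)"
  shows
    "(\<forall>(p::nat) (k::nat) (f::'a list \<Rightarrow> 'a). 1 \<le> p \<longrightarrow> 0 < k \<longrightarrow> k < r ^ p - 1 \<longrightarrow>
       (block_map_on r \<theta> 1 0 f \<in> Aut r \<theta> \<and>
        kappa r \<theta> (block_map_on r \<theta> 1 0 f) = radic_quotient r (int k) (1 - int r ^ p))
       \<longleftrightarrow>
       ((\<forall>x0 x1 x2. [x0, x1, x2] \<in> language r \<theta> \<longrightarrow> [f [x0, x1], f [x1, x2]] \<in> language r \<theta>) \<and>
        (\<forall>y x0 x1. [y, x0, x1] \<in> language r \<theta> \<longrightarrow>
          (\<forall>i<r ^ (fact c * p).
            f [subst_dotted_nth \<theta> (fact c * p) [y] [x0] (int i - 1),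
               subst_dotted_nth \<theta> (fact c * p) [y] [x0] (int i)]
            = (subst_word \<theta> ^^ (fact c * p)) [f [y, x0], f [x0, x1]]
                ! (k * (\<Sum>j<fact c. r ^ (j * p)) + i)))))
     \<and>
     (\<forall>g::'a list \<Rightarrow> 'a.
       (block_map_on r \<theta> 1 1 g \<in> Aut r \<theta> \<and>
        kappa r \<theta> (block_map_on r \<theta> 1 1 g) = \<zero>\<^bsub>radic r\<^esub>)
       \<longleftrightarrow>
       ((\<forall>x0 x1 x2 x3. [x0, x1, x2, x3] \<in> language r \<theta> \<longrightarrow>
          [g [x0, x1, x2], g [x1, x2, x3]] \<in> language r \<theta>) \<and>
        (\<forall>y x0 x1. [y, x0, x1] \<in> language r \<theta> \<longrightarrow>
          (\<forall>i<r ^ fact c.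
            g [subst_dotted_nth \<theta> (fact c) [y] [x0, x1] (int i - 1),
               subst_dotted_nth \<theta> (fact c) [y] [x0, x1] (int i),
               subst_dotted_nth \<theta> (fact c) [y] [x0, x1] (int i + 1)]
            = (subst_word \<theta> ^^ fact c) [g [y, x0, x1]] ! i))))"
proof -
  have "2 \<le> r"
    using length_ge_2_of_primitive assms(1,3,6) .
  then interpret aperiodic_substitution \<theta> r
    using assms(1-3,6) by unfold_locales
  show ?thesis
    using automorphism_1_0_iff[OF _ _ assms(5)] automorphism_1_1_iff[OF assms(5)] by auto
qed

end
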